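(* Let $n\geq 8$. Then $R(S_n(2,2),W_8)=2n-1$ if $n\not\equiv 0\pmod 4$, and $R(S_n(2,2),W_8)=2n$ if $n\equiv 0\pmod 4$.
   Context: All graphs are finite and simple. For graphs $G,H$, $R(G,H)$ is the smallest $N$ such that every graph $F$ of order $N$ either contains $G$ as a subgraph or has complement $\overline{F}$ containing $H$. $W_8$ is the wheel of order 9 (a hub joined to every vertex of a cycle $C_8$). $S_k$ is the star of order $k$. $S_n(2,2)$ is the tree of order $n$ obtained from $S_{n-4}$ by subdividing each of two chosen edges twice, i.e. a center adjacent to $n-7$ leaves together with two pendant paths of 3 edges each starting at the center. *)

theory Defs
  imports "Graph_Theory.Graph_Theory"
begin

text \<open>
  Finite simple graphs are the graphs of the locale \<^locale>\<open>pair_graph\<close>: a finite vertex set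
  together with a symmetric irreflexive adjacency relation on it. An undirected edge is thus
  represented by its two arcs.
\<close>

definition complement_graph :: "'a pair_pre_digraph \<Rightarrow> 'a pair_pre_digraph" where
  "complement_graph F =
    \<lparr>pverts = pverts F,
     parcs = {(u, v). u \<in> pverts F \<and> v \<in> pverts F \<and> u \<noteq> v \<and> (u, v) \<notin> parcs F}\<rparr>"

lemma pair_graph_complement_graph:
  assumes "pair_graph F"
  shows "pair_graph (complement_graph F)"
proof -
  interpret F: pair_graph F by fact
  have "parcs (complement_graph F) \<subseteq> pverts F \<times> pverts F"
    by (auto simp: complement_graph_def)
  then have "finite (parcs (complement_graph F))"
    using F.pair_finite_verts finite_subset by blast
  then show ?thesis
    using F.pair_finite_verts
    by unfold_locales
      (auto simp: complement_graph_def symmetric_def intro!: symI dest: F.arcs_symmetric)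
qed

definition contains_graph :: "'b pair_pre_digraph \<Rightarrow> 'a pair_pre_digraph \<Rightarrow> bool" where
  "contains_graph F G \<longleftrightarrow>
    (\<exists>S :: 'b pair_pre_digraph.
      subgraph (with_proj S) (with_proj F) \<and> digraph_iso (with_proj G) (with_proj S))"

lemma contains_graph_iff:
  assumes "pair_wf_digraph F" "pair_wf_digraph G"
  shows "contains_graph F G \<longleftrightarrow>
    (\<exists>f. inj_on f (pverts G) \<and> f ` pverts G \<subseteq> pverts F \<and>
         (\<forall>u v. (u, v) \<in> parcs G \<longrightarrow> (f u, f v) \<in> parcs F))"
proof -
  interpret F: pair_wf_digraph F by fact
  interpret G: pair_wf_digraph G by fact
  show ?thesis
  proof
    assume "contains_graph F G"
    then obtain S h where S: "subgraph (with_proj S) (with_proj F)"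
      and h: "pre_digraph.digraph_isomorphism (with_proj G) h"
      and eq: "with_proj S = app_iso h (with_proj G)"
      by (auto simp: contains_graph_def digraph_iso_def)
    let ?f = "iso_verts h"
    have v: "pverts S = ?f ` pverts G" and a: "parcs S = iso_arcs h ` parcs G"
      and t: "fst = iso_tail h" and d: "snd = iso_head h"
      using arg_cong[OF eq, of verts] arg_cong[OF eq, of arcs]
        arg_cong[OF eq, of tail] arg_cong[OF eq, of head] by simp_all
    have "iso_arcs h (u, w) = (?f u, ?f w)" if "(u, w) \<in> parcs G" for u w
      using h that unfolding pre_digraph.digraph_isomorphism_def t[symmetric] d[symmetric]
      by (force intro: prod_eqI)
    then have "\<forall>u w. (u, w) \<in> parcs G \<longrightarrow> (?f u, ?f w) \<in> parcs F"
      using S a unfolding subgraph_def with_proj_simps by (metis image_eqI subsetD)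
    moreover have "inj_on ?f (pverts G)"
      using h by (simp add: pre_digraph.digraph_isomorphism_def)
    moreover have "?f ` pverts G \<subseteq> pverts F"
      using S v by (simp add: subgraph_def)
    ultimately show "\<exists>f. inj_on f (pverts G) \<and> f ` pverts G \<subseteq> pverts F \<and>
         (\<forall>u v. (u, v) \<in> parcs G \<longrightarrow> (f u, f v) \<in> parcs F)"
      by blast
  next
    assume "\<exists>f. inj_on f (pverts G) \<and> f ` pverts G \<subseteq> pverts F \<and>
         (\<forall>u v. (u, v) \<in> parcs G \<longrightarrow> (f u, f v) \<in> parcs F)"
    then obtain f where inj: "inj_on f (pverts G)" and sub: "f ` pverts G \<subseteq> pverts F"
      and arc: "\<And>u v. (u, v) \<in> parcs G \<Longrightarrow> (f u, f v) \<in> parcs F" by blast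
    define S where "S = \<lparr>pverts = f ` pverts G, parcs = map_prod f f ` parcs G\<rparr>"
    define h where "h = \<lparr>iso_verts = f, iso_arcs = map_prod f f, iso_head = snd, iso_tail = fst\<rparr>"
    have "pair_wf_digraph S"
      by unfold_locales (auto simp: S_def dest: G.in_arcsD1 G.in_arcsD2)
    then have "wf_digraph (with_proj S)"
      by (simp add: wf_digraph_wp_iff)
    then have "subgraph (with_proj S) (with_proj F)"
      using sub arc F.wf_digraph by (auto simp: subgraph_def S_def compatible_def)
    moreover have "parcs G \<subseteq> pverts G \<times> pverts G"
      by (auto dest: G.in_arcsD1 G.in_arcsD2)
    then have "inj_on (map_prod f f) (parcs G)"
      using map_prod_inj_on[OF inj inj] inj_on_subset by blast
    then have "pre_digraph.digraph_isomorphism (with_proj G) h"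
      using inj G.wf_digraph by (simp add: pre_digraph.digraph_isomorphism_def h_def)
    then have "digraph_iso (with_proj G) (with_proj S)"
      unfolding digraph_iso_def
      by (intro exI[of _ h]) (simp add: app_iso_def h_def S_def with_proj_def)
    ultimately show "contains_graph F G"
      by (auto simp: contains_graph_def)
  qed
qed

text \<open>
  The graphs \<open>F\<close> range over the finite simple graphs with vertices in \<^typ>\<open>nat\<close>; every finite
  graph is isomorphic to one of these (see \<open>ramsey_arrow_any\<close>).
\<close>

definition ramsey_arrow :: "nat \<Rightarrow> 'a pair_pre_digraph \<Rightarrow> 'b pair_pre_digraph \<Rightarrow> bool" where
  "ramsey_arrow N G H \<longleftrightarrow>
    (\<forall>F :: nat pair_pre_digraph. pair_graph F \<and> card (pverts F) = N \<longrightarrow>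
       contains_graph F G \<or> contains_graph (complement_graph F) H)"

definition ramsey_number :: "'a pair_pre_digraph \<Rightarrow> 'b pair_pre_digraph \<Rightarrow> nat" where
  "ramsey_number G H = (LEAST N. ramsey_arrow N G H)"

lemma ramsey_arrow_any:
  fixes F :: "'c pair_pre_digraph"
  assumes N: "ramsey_arrow N G H" and G: "pair_graph G" and H: "pair_graph H"
    and F: "pair_graph F" and card: "card (pverts F) = N"
  shows "contains_graph F G \<or> contains_graph (complement_graph F) H"
proof -
  interpret F: pair_graph F by fact
  obtain e :: "'c \<Rightarrow> nat" where e: "inj_on e (pverts F)"
    using finite_imp_inj_to_nat_seg[OF F.pair_finite_verts] by metis
  define g where "g = the_inv_into (pverts F) e"
  define F' where "F' = \<lparr>pverts = e ` pverts F, parcs = map_prod e e ` parcs F\<rparr>"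
  have ge: "g (e x) = x" if "x \<in> pverts F" for x
    using e that by (simp add: g_def the_inv_into_f_f)
  have inj_g: "inj_on g (pverts F')"
    by (auto simp: F'_def ge intro!: inj_onI)
  have arc: "(g u, g v) \<in> parcs F \<longleftrightarrow> (u, v) \<in> parcs F'"
    if uv: "u \<in> pverts F'" "v \<in> pverts F'" for u v
  proof -
    obtain x y where xy: "x \<in> pverts F" "y \<in> pverts F" "u = e x" "v = e y"
      using uv by (auto simp: F'_def)
    have "(e x, e y) \<in> parcs F' \<longleftrightarrow> (x, y) \<in> parcs F"
    proof
      assume "(e x, e y) \<in> parcs F'"
      then obtain x' y' where "(x', y') \<in> parcs F" "e x' = e x" "e y' = e y"
        by (auto simp: F'_def)
      then show "(x, y) \<in> parcs F"
        using xy(1,2) ge F.in_arcsD1 F.in_arcsD2 by metis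
    next
      assume "(x, y) \<in> parcs F"
      then have "map_prod e e (x, y) \<in> map_prod e e ` parcs F" by (rule imageI)
      then show "(e x, e y) \<in> parcs F'" by (simp add: F'_def)
    qed
    with xy show ?thesis by (simp add: ge)
  qed
  have im: "g ` pverts F' = pverts F"
    by (auto simp: F'_def ge image_image)
  have F': "pair_graph F'"
  proof
    show "symmetric (with_proj F')"
      using F.arcs_symmetric by (fastforce simp: F'_def symmetric_def intro!: symI)
    show "fst a \<noteq> snd a" if a: "a \<in> parcs F'" for a
    proof -
      obtain u v where uv: "(u, v) \<in> parcs F" "a = (e u, e v)"
        using a by (auto simp: F'_def)
      have "u \<noteq> v" using F.pair_no_loops[OF uv(1)] by simp
      with uv show ?thesis
        using e F.in_arcsD1 F.in_arcsD2 by (auto dest: inj_onD)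
    qed
  qed (use F.pair_finite_verts F.pair_finite_arcs F.in_arcsD1 F.in_arcsD2 in
        \<open>auto simp: F'_def\<close>)
  then have wf: "pair_wf_digraph F" "pair_wf_digraph F'"
      "pair_wf_digraph (complement_graph F)" "pair_wf_digraph (complement_graph F')"
      "pair_wf_digraph G" "pair_wf_digraph H"
    using F G H pair_graph_complement_graph
    by (meson pair_graph_def pair_digraph_def pair_fin_digraph_def)+
  have "card (pverts F') = N"
    using card e by (simp add: F'_def card_image)
  then consider "contains_graph F' G" | "contains_graph (complement_graph F') H"
    using N F' by (auto simp: ramsey_arrow_def)
  then show ?thesis
  proof cases
    case 1
    then obtain f where f: "inj_on f (pverts G)" "f ` pverts G \<subseteq> pverts F'"
      "\<And>u v. (u, v) \<in> parcs G \<Longrightarrow> (f u, f v) \<in> parcs F'"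
      using contains_graph_iff[OF wf(2,5)] by blast
    have "inj_on (g \<circ> f) (pverts G)"
      using f(1,2) inj_g by (meson comp_inj_on inj_on_subset)
    moreover have "(g \<circ> f) ` pverts G \<subseteq> pverts F"
      using f(2) im by auto
    moreover have "\<forall>u v. (u, v) \<in> parcs G \<longrightarrow> ((g \<circ> f) u, (g \<circ> f) v) \<in> parcs F"
      using f(3) arc pair_wf_digraph.wellformed'[OF wf(2)] by fastforce
    ultimately show ?thesis
      using contains_graph_iff[OF wf(1,5)] by blast
  next
    case 2
    then obtain f where f: "inj_on f (pverts H)" "f ` pverts H \<subseteq> pverts F'"
      "\<And>u v. (u, v) \<in> parcs H \<Longrightarrow> (f u, f v) \<in> parcs (complement_graph F')"
      using contains_graph_iff[OF wf(4,6)] by (auto simp: complement_graph_def)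
    have "inj_on (g \<circ> f) (pverts H)"
      using f(1,2) inj_g by (meson comp_inj_on inj_on_subset)
    moreover have "(g \<circ> f) ` pverts H \<subseteq> pverts (complement_graph F)"
      using f(2) im by (auto simp: complement_graph_def)
    moreover have "((g \<circ> f) u, (g \<circ> f) v) \<in> parcs (complement_graph F)"
      if "(u, v) \<in> parcs H" for u v
      using f(3)[OF that] arc im inj_g by (auto simp: complement_graph_def dest: inj_onD)
    ultimately show ?thesis
      using contains_graph_iff[OF wf(3,6)] by blast
  qed
qed

definition wheel :: "nat \<Rightarrow> nat pair_pre_digraph" where
  \<comment> \<open>\<open>wheel m\<close> has order \<open>m + 1\<close>: rim cycle \<open>0, \<dots>, m - 1\<close> and hub \<open>m\<close>; intended for \<open>m \<ge> 3\<close>\<close>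
  "wheel m = mk_symmetric (with_proj
    \<lparr>pverts = {..m}, parcs = {(i, Suc i mod m) | i. i < m} \<union> {(m, i) | i. i < m}\<rparr>)"

definition star :: "nat \<Rightarrow> nat pair_pre_digraph" where
  \<comment> \<open>\<open>star k\<close> has order \<open>k\<close> and center \<open>0\<close>; intended for \<open>k \<ge> 1\<close>\<close>
  "star k = mk_symmetric (with_proj \<lparr>pverts = {..<k}, parcs = {(0, i) | i. 1 \<le> i \<and> i < k}\<rparr>)"

definition star22 :: "nat \<Rightarrow> nat pair_pre_digraph" where
  \<comment> \<open>\<open>S\<^sub>n(2,2)\<close>: the edges \<open>01\<close> and \<open>02\<close> of \<open>star (n - 4)\<close> become the paths
     \<open>0, n-4, n-3, 1\<close> and \<open>0, n-2, n-1, 2\<close>; intended for \<open>n \<ge> 7\<close>\<close>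
  "star22 n =
    (let T = subdivide (subdivide (star (n - 4)) (0, 1) (n - 4)) (n - 4, 1) (n - 3)
     in subdivide (subdivide T (0, 2) (n - 2)) (n - 2, 2) (n - 1))"

lemma pair_graph_mk_symmetric:
  assumes V: "finite V" and A: "A \<subseteq> V \<times> V" and irrefl: "\<And>v. (v, v) \<notin> A"
  shows "pair_graph (mk_symmetric (with_proj \<lparr>pverts = V, parcs = A\<rparr>))" (is "pair_graph ?G")
proof -
  have arcs: "parcs ?G = A \<union> A\<inverse>"
    by (auto simp: parcs_mk_symmetric)
  have "finite A"
    using V A finite_subset by blast
  then show ?thesis
    using V A irrefl by unfold_locales (auto simp: arcs symmetric_def sym_Un_converse)
qed

lemma pair_graph_wheel:
  assumes "m \<ge> 3"
  shows "pair_graph (wheel m)"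
proof -
  have "i \<noteq> Suc i mod m" if "i < m" for i
    using assms that by (cases "Suc i = m") auto
  then show ?thesis
    unfolding wheel_def using assms
    by (intro pair_graph_mk_symmetric) (auto intro: less_imp_le)
qed

lemma card_pverts_wheel: "card (pverts (wheel m)) = m + 1"
  by (simp add: wheel_def)

lemma pair_graph_star: "pair_graph (star k)"
  unfolding star_def by (intro pair_graph_mk_symmetric) auto

lemma pverts_star22:
  assumes "n \<ge> 7"
  shows "pverts (star22 n) = {..<n}"
  using assms by (auto simp: star22_def star_def Let_def subdivide.simps)

lemma parcs_star22:
  assumes "n \<ge> 7"
  shows "parcs (star22 n) =
    (let A = {(0, i) | i. 3 \<le> i \<and> i \<le> n - 5}
           \<union> {(0, n - 4), (n - 4, n - 3), (n - 3, 1), (0, n - 2), (n - 2, n - 1), (n - 1, 2)}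
     in A \<union> A\<inverse>)" (is "_ = ?R")
proof -
  let ?S = "{(0, i) | i. 1 \<le> i \<and> i < n - 4}"
  define L where "L = {(0 :: nat, i) | i. 3 \<le> i \<and> i \<le> n - 5}"
  have "parcs (star (n - 4)) = ?S \<union> ?S\<inverse>"
    by (auto simp: star_def parcs_mk_symmetric)
  also have "?S = L \<union> {(0, 1), (0, 2)}"
    using assms by (auto simp: L_def)
  finally have star: "parcs (star (n - 4)) = (L \<union> L\<inverse>) \<union> {(0, 1), (0, 2), (1, 0), (2, 0)}"
    by auto
  obtain k where k: "n = k + 7"
    using assms by (metis add.commute le_Suc_ex)
  have sd: "parcs (subdivide G (u, v) w) = M \<union> {(u, w), (w, u), (w, v), (v, w)}"
    if "parcs G = M \<union> {(u, v), (v, u)}" "(u, v) \<notin> M" "(v, u) \<notin> M" for G M and u v w :: nat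
    using that by (auto simp: subdivide.simps)
  let ?M = "L \<union> L\<inverse>"
  let ?P = "{(0, k + 3), (k + 3, 0), (k + 3, k + 4), (k + 4, k + 3), (k + 4, 1), (1, k + 4)}"
  let ?T1 = "subdivide (star (n - 4)) (0, 1) (k + 3)"
  let ?T2 = "subdivide ?T1 (k + 3, 1) (k + 4)"
  let ?T3 = "subdivide ?T2 (0, 2) (k + 5)"
  have "parcs ?T1 = (?M \<union> {(0, 2), (2, 0)}) \<union> {(0, k + 3), (k + 3, 0), (k + 3, 1), (1, k + 3)}"
    by (rule sd) (auto simp: star L_def)
  then have "parcs ?T1 = (?M \<union> {(0, 2), (2, 0), (0, k + 3), (k + 3, 0)}) \<union> {(k + 3, 1), (1, k + 3)}"
    by (simp add: insert_commute)
  then have "parcs ?T2 = (?M \<union> {(0, 2), (2, 0), (0, k + 3), (k + 3, 0)})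
      \<union> {(k + 3, k + 4), (k + 4, k + 3), (k + 4, 1), (1, k + 4)}"
    by (rule sd) (auto simp: L_def)
  then have "parcs ?T2 = (?M \<union> ?P) \<union> {(0, 2), (2, 0)}"
    by (simp add: insert_commute)
  then have "parcs ?T3 = (?M \<union> ?P) \<union> {(0, k + 5), (k + 5, 0), (k + 5, 2), (2, k + 5)}"
    by (rule sd) (auto simp: L_def)
  then have "parcs ?T3 = (?M \<union> ?P \<union> {(0, k + 5), (k + 5, 0)}) \<union> {(k + 5, 2), (2, k + 5)}"
    by (simp add: insert_commute)
  then have "parcs (subdivide ?T3 (k + 5, 2) (k + 6)) = (?M \<union> ?P \<union> {(0, k + 5), (k + 5, 0)})
      \<union> {(k + 5, k + 6), (k + 6, k + 5), (k + 6, 2), (2, k + 6)}"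
    by (rule sd) (auto simp: L_def)
  moreover have "?R = ?M \<union> ?P \<union> {(0, k + 5), (k + 5, 0)}
      \<union> {(k + 5, k + 6), (k + 6, k + 5), (k + 6, 2), (2, k + 6)}"
  proof -
    let ?B = "{(0, k + 3), (k + 3, k + 4), (k + 4, 1), (0, k + 5), (k + 5, k + 6), (k + 6, 2)}"
    have "?R = (L \<union> ?B) \<union> (L \<union> ?B)\<inverse>"
      by (simp add: L_def k Let_def add.commute)
    moreover have "?B\<inverse> =
        {(k + 3, 0), (k + 4, k + 3), (1, k + 4), (k + 5, 0), (k + 6, k + 5), (2, k + 6)}"
      unfolding converse_unfold by blast
    ultimately show ?thesis
      by (simp only: converse_Un) blast
  qed
  moreover have "n - 3 = k + 4" "n - 2 = k + 5" "n - 1 = k + 6" "n - 4 = k + 3"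
    using k by simp_all
  then have "star22 n = subdivide ?T3 (k + 5, 2) (k + 6)"
    by (simp only: star22_def Let_def)
  ultimately show ?thesis
    by (simp only:)
qed

lemma pair_graph_star22:
  assumes "n \<ge> 7"
  shows "pair_graph (star22 n)"
proof -
  let ?T1 = "subdivide (star (n - 4)) (0, 1) (n - 4)"
  let ?T2 = "subdivide ?T1 (n - 4, 1) (n - 3)"
  let ?T3 = "subdivide ?T2 (0, 2) (n - 2)"
  have "pair_graph ?T1"
    by (rule pair_graph.pair_graph_subdivide[OF pair_graph_star])
      (use assms in \<open>auto simp: star_def parcs_mk_symmetric\<close>)
  then have "pair_graph ?T2"
    by (rule pair_graph.pair_graph_subdivide)
      (use assms in \<open>auto simp: subdivide.simps star_def\<close>)
  then have "pair_graph ?T3"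
    by (rule pair_graph.pair_graph_subdivide)
      (use assms in \<open>auto simp: subdivide.simps star_def parcs_mk_symmetric\<close>)
  then have "pair_graph (subdivide ?T3 (n - 2, 2) (n - 1))"
    by (rule pair_graph.pair_graph_subdivide)
      (use assms in \<open>auto simp: subdivide.simps star_def\<close>)
  then show ?thesis
    by (simp add: star22_def Let_def)
qed

end

theory Submission
  imports Defs
begin

text \<open>
  Call the edges of \<open>F\<close> red and those of its complement blue, and suppose that there is neither a
  red \<open>S\<^sub>n(2,2)\<close> nor a blue \<open>W\<^sub>8\<close>. If every red degree is below \<open>n - 5\<close>, the common blue
  neighbourhood \<open>C\<close> of a blue edge \<open>uv\<close> has at least nine vertices and no blue path on seven vertices,
  so it is almost entirely red; its vertices then have few red neighbours outside \<open>C\<close>, and four of them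
  alternate with blue neighbours of \<open>u\<close> on the rim of a blue wheel with hub \<open>u\<close>. Hence some vertex
  \<open>v\<close> has large red degree. As there are no two disjoint red paths that continue the star at \<open>v\<close> to
  \<open>S\<^sub>n(2,2)\<close>, the vertices of at most one such path separate the rest into two sides joined
  completely in blue. Inside a side all blue degrees are at most three, and the exceptional vertices
  can be added to the sides without changing this. So a side with \<open>n\<close> vertices contains a red
  \<open>S\<^sub>n(2,2)\<close> unless its blue graph is a disjoint union of \<open>K\<^sub>4\<close>, which needs \<open>4 dvd n\<close>. The lower
  bounds come from two red cliques of order \<open>n - 1\<close> and, if \<open>4 dvd n\<close>, from a red clique of order
  \<open>n - 1\<close> and a red complete multipartite graph with parts of size four.
\<close>

subsection \<open>Blue wheels and red trees\<close>

text \<open>Greedy choice: paths and rims are built vertex by vertex, each new vertex avoiding the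
  list of those already used.\<close>

lemma ex_not_in_list:
  assumes "length xs < card S"
  shows "\<exists>x\<in>S. x \<notin> set xs"
proof (rule ccontr)
  assume "\<not> ?thesis"
  then have "S \<subseteq> set xs" by blast
  then have "card S \<le> length xs"
    by (meson List.finite_set card_length card_mono le_trans)
  with assms show False by simp
qed

lemma ex_distinct_list:
  assumes "k \<le> card S"
  shows "\<exists>xs. length xs = k \<and> distinct xs \<and> set xs \<subseteq> S"
proof -
  obtain T where "T \<subseteq> S" "card T = k" "finite T"
    using obtain_subset_with_card_n[OF assms] by metis
  then show ?thesis
    by (metis finite_distinct_list distinct_card)
qed

lemma ex_two: "2 \<le> card S \<Longrightarrow> \<exists>x y. x \<in> S \<and> y \<in> S \<and> x \<noteq> y"
  by (metis One_nat_def Suc_1 card_le_Suc0_iff_eq card.infinite le_zero_eq not_less_eq_eq nat.distinct(1))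

lemma ex_four:
  assumes "4 \<le> card S"
  shows "\<exists>w x y z. {w, x, y, z} \<subseteq> S \<and> distinct [w, x, y, z]"
proof -
  obtain xs where xs: "length xs = 4" "distinct xs" "set xs \<subseteq> S"
    using ex_distinct_list[OF assms] by blast
  then obtain w x y z where "xs = [w, x, y, z]"
    by (auto simp: numeral_eq_Suc length_Suc_conv)
  with xs have "{w, x, y, z} \<subseteq> S \<and> distinct [w, x, y, z]"
    by simp
  then show ?thesis by blast
qed

lemma ex_three:
  assumes "3 \<le> card S"
  shows "\<exists>x y z. {x, y, z} \<subseteq> S \<and> distinct [x, y, z]"
proof -
  obtain xs where xs: "length xs = 3" "distinct xs" "set xs \<subseteq> S"
    using ex_distinct_list[OF assms] by blast
  then obtain x y z where "xs = [x, y, z]"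
    by (auto simp: numeral_eq_Suc length_Suc_conv)
  with xs have "{x, y, z} \<subseteq> S \<and> distinct [x, y, z]"
    by simp
  then show ?thesis by blast
qed

text \<open>The sets are served in order, and each has to avoid only the representatives of the
  earlier ones, so the later sets get the larger bounds. \<open>wheel_alternating\<close> inherits
  this asymmetry.\<close>

lemma ex_distinct_representatives4:
  assumes "2 \<le> card S1" "2 \<le> card S2" "4 \<le> card S3" "4 \<le> card S4"
  shows "\<exists>a\<in>S1. \<exists>b\<in>S2. \<exists>c\<in>S3. \<exists>d\<in>S4. distinct [a, b, c, d]"
proof -
  obtain a where "a \<in> S1" using ex_not_in_list[of "[]" S1] assms by auto
  moreover obtain b where "b \<in> S2" "b \<notin> set [a]" using ex_not_in_list[of "[a]" S2] assms by auto
  moreover obtain c where "c \<in> S3" "c \<notin> set [a, b]" using ex_not_in_list[of "[a, b]" S3] assms by auto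
  moreover obtain d where "d \<in> S4" "d \<notin> set [a, b, c]" using ex_not_in_list[of "[a, b, c]" S4] assms by auto
  ultimately have "distinct [a, b, c, d]" by auto
  with \<open>a \<in> S1\<close> \<open>b \<in> S2\<close> \<open>c \<in> S3\<close> \<open>d \<in> S4\<close> show ?thesis by blast
qed

text \<open>A two-coloured complete graph with \<open>R\<close> as red. The parameter
  \<open>n\<close> is the order of the tree; it is independent of the order of
  \<open>V\<close>.\<close>

locale red_blue =
  fixes V :: "'a set" and R :: "'a \<Rightarrow> 'a \<Rightarrow> bool" and n :: nat
  assumes finite_V: "finite V" and R_sym: "R x y \<Longrightarrow> R y x" and R_irrefl: "\<not> R x x"
begin

definition B :: "'a \<Rightarrow> 'a \<Rightarrow> bool" where "B x y \<longleftrightarrow> x \<noteq> y \<and> \<not> R x y"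

text \<open>Neighbourhoods are relative to a set, because degrees inside a side, into the other side
  and in all of \<open>V\<close> are compared.\<close>

definition red_nb :: "'a set \<Rightarrow> 'a \<Rightarrow> 'a set" where "red_nb S x = {y \<in> S. R x y}"

definition blue_nb :: "'a set \<Rightarrow> 'a \<Rightarrow> 'a set" where "blue_nb S x = {y \<in> S. B x y}"

definition has_wheel :: bool where
  "has_wheel \<longleftrightarrow> (\<exists>h x0 x1 x2 x3 x4 x5 x6 x7. distinct [h, x0, x1, x2, x3, x4, x5, x6, x7] \<and>
     {h, x0, x1, x2, x3, x4, x5, x6, x7} \<subseteq> V \<and>
     (\<forall>x \<in> {x0, x1, x2, x3, x4, x5, x6, x7}. B h x) \<and>
     B x0 x1 \<and> B x1 x2 \<and> B x2 x3 \<and> B x3 x4 \<and> B x4 x5 \<and> B x5 x6 \<and> B x6 x7 \<and> B x7 x0)"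

text \<open>This is a red \<open>S\<^sub>n(2,2)\<close> with center \<open>v\<close>, long paths
  \<open>v a1 b1 c1\<close> and \<open>v a2 b2 c2\<close>, and leaf set \<open>L\<close>.\<close>

definition has_tree :: bool where
  "has_tree \<longleftrightarrow> (\<exists>v a1 b1 c1 a2 b2 c2 L. distinct [v, a1, b1, c1, a2, b2, c2] \<and>
     {v, a1, b1, c1, a2, b2, c2} \<subseteq> V \<and> L \<subseteq> V \<and> L \<inter> {v, a1, b1, c1, a2, b2, c2} = {} \<and>
     card L = n - 7 \<and> (\<forall>l\<in>L. R v l) \<and>
     R v a1 \<and> R a1 b1 \<and> R b1 c1 \<and> R v a2 \<and> R a2 b2 \<and> R b2 c2)"

lemma B_sym: "B x y \<Longrightarrow> B y x"
  by (auto simp: B_def R_sym)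

lemma R_commute: "R x y \<longleftrightarrow> R y x" and B_commute: "B x y \<longleftrightarrow> B y x"
  using R_sym B_sym by blast+

lemma B_irrefl: "\<not> B x x"
  by (simp add: B_def)

lemma finite_subset_V: "S \<subseteq> V \<Longrightarrow> finite S"
  using finite_V finite_subset by blast

lemma red_nb_subset: "red_nb S x \<subseteq> S" and blue_nb_subset: "blue_nb S x \<subseteq> S"
  by (auto simp: red_nb_def blue_nb_def)

lemma red_nb_mono: "S \<subseteq> T \<Longrightarrow> red_nb S x \<subseteq> red_nb T x" and blue_nb_mono: "S \<subseteq> T \<Longrightarrow> blue_nb S x \<subseteq> blue_nb T x"
  by (auto simp: red_nb_def blue_nb_def)

lemma card_red_nb_mono: "S \<subseteq> T \<Longrightarrow> T \<subseteq> V \<Longrightarrow> card (red_nb S x) \<le> card (red_nb T x)"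
  by (meson card_mono finite_subset_V order_trans red_nb_mono red_nb_subset)

lemma card_blue_nb_mono: "S \<subseteq> T \<Longrightarrow> T \<subseteq> V \<Longrightarrow> card (blue_nb S x) \<le> card (blue_nb T x)"
  by (meson card_mono finite_subset_V order_trans blue_nb_mono blue_nb_subset)

lemma card_neighbours_mem: "S \<subseteq> V \<Longrightarrow> x \<in> S \<Longrightarrow> card S = Suc (card (red_nb S x) + card (blue_nb S x))"
proof -
  assume S: "S \<subseteq> V" "x \<in> S"
  have "S - {x} = red_nb S x \<union> blue_nb S x" "red_nb S x \<inter> blue_nb S x = {}"
    using R_irrefl by (auto simp: red_nb_def blue_nb_def B_def)
  moreover have "finite (red_nb S x)" "finite (blue_nb S x)"
    using S(1) finite_subset_V red_nb_subset blue_nb_subset by (meson order_trans)+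
  ultimately have "card (S - {x}) = card (red_nb S x) + card (blue_nb S x)"
    by (simp add: card_Un_disjoint)
  with S finite_subset_V[OF S(1)] show ?thesis
    by (metis card.remove)
qed

lemma card_neighbours_notin: "S \<subseteq> V \<Longrightarrow> x \<notin> S \<Longrightarrow> card S = card (red_nb S x) + card (blue_nb S x)"
proof -
  assume S: "S \<subseteq> V" "x \<notin> S"
  have "S = red_nb S x \<union> blue_nb S x" "red_nb S x \<inter> blue_nb S x = {}"
    using S by (auto simp: red_nb_def blue_nb_def B_def)
  moreover have "finite (red_nb S x)" "finite (blue_nb S x)"
    using S(1) finite_subset_V red_nb_subset blue_nb_subset by (meson order_trans)+
  ultimately show ?thesis
    by (metis card_Un_disjoint)
qed

lemma card_red_nb_Un: "S \<subseteq> V \<Longrightarrow> T \<subseteq> V \<Longrightarrow> S \<inter> T = {} \<Longrightarrow>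
    card (red_nb (S \<union> T) x) = card (red_nb S x) + card (red_nb T x)"
proof -
  assume *: "S \<subseteq> V" "T \<subseteq> V" "S \<inter> T = {}"
  have "red_nb (S \<union> T) x = red_nb S x \<union> red_nb T x" "red_nb S x \<inter> red_nb T x = {}"
    using * by (auto simp: red_nb_def)
  moreover have "finite (red_nb S x)" "finite (red_nb T x)"
    using * finite_subset_V red_nb_subset by (meson order_trans)+
  ultimately show ?thesis
    by (simp add: card_Un_disjoint)
qed

lemma card_blue_nb_Un: "S \<subseteq> V \<Longrightarrow> T \<subseteq> V \<Longrightarrow> S \<inter> T = {} \<Longrightarrow>
    card (blue_nb (S \<union> T) x) = card (blue_nb S x) + card (blue_nb T x)"
proof -
  assume *: "S \<subseteq> V" "T \<subseteq> V" "S \<inter> T = {}"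
  have "blue_nb (S \<union> T) x = blue_nb S x \<union> blue_nb T x" "blue_nb S x \<inter> blue_nb T x = {}"
    using * by (auto simp: blue_nb_def)
  moreover have "finite (blue_nb S x)" "finite (blue_nb T x)"
    using * finite_subset_V blue_nb_subset by (meson order_trans)+
  ultimately show ?thesis
    by (simp add: card_Un_disjoint)
qed

lemma treeI:
  assumes "distinct [v, a1, b1, c1, a2, b2, c2]" "{v, a1, b1, c1, a2, b2, c2} \<subseteq> V"
    "R v a1" "R a1 b1" "R b1 c1" "R v a2" "R a2 b2" "R b2 c2"
    and L: "n - 7 \<le> card (red_nb V v - {a1, b1, c1, a2, b2, c2})"
  shows has_tree
proof -
  obtain L where L: "L \<subseteq> red_nb V v - {a1, b1, c1, a2, b2, c2}" "card L = n - 7"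
    using obtain_subset_with_card_n[OF L] by metis
  then have "\<forall>l\<in>L. R v l" "L \<subseteq> V" "L \<inter> {v, a1, b1, c1, a2, b2, c2} = {}"
    using R_irrefl by (auto simp: red_nb_def)
  then show ?thesis
    unfolding has_tree_def using assms L(2) by (intro exI conjI) assumption+
qed

lemma wheelI:
  assumes "distinct [h, x0, x1, x2, x3, x4, x5, x6, x7]"
     "{h, x0, x1, x2, x3, x4, x5, x6, x7} \<subseteq> V"
     "\<forall>x \<in> {x0, x1, x2, x3, x4, x5, x6, x7}. B h x"
     "B x0 x1" "B x1 x2" "B x2 x3" "B x3 x4" "B x4 x5" "B x5 x6" "B x6 x7" "B x7 x0"
  shows has_wheel
  unfolding has_wheel_def using assms by (intro exI conjI) assumption+

text \<open>The rim is \<open>k1 o1 k2 o2 k3 o3 k4 o4\<close> with the \<open>o\<close>s in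
  \<open>Q\<close>. A vertex of \<open>Q\<close> is unfit for a gap only if it is red to the hub or
  to one of the two \<open>k\<close>s beside the gap, so a union bound leaves enough candidates. The
  two gaps at \<open>k2\<close> need fewer candidates, which suits a \<open>k2\<close> with many red
  edges.\<close>

lemma wheel_alternating:
  assumes Q: "Q \<subseteq> V" and ks: "distinct [h, k1, k2, k3, k4]" "{h, k1, k2, k3, k4} \<subseteq> V - Q"
    and B: "B h k1" "B h k2" "B h k3" "B h k4"
    and c: "2 + card (red_nb Q h) + card (red_nb Q k1) + card (red_nb Q k2) \<le> card Q"
      "2 + card (red_nb Q h) + card (red_nb Q k2) + card (red_nb Q k3) \<le> card Q"
      "4 + card (red_nb Q h) + card (red_nb Q k3) + card (red_nb Q k4) \<le> card Q"
      "4 + card (red_nb Q h) + card (red_nb Q k4) + card (red_nb Q k1) \<le> card Q"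
  shows has_wheel
proof -
  define S where "S k k' = Q - (red_nb Q h \<union> red_nb Q k \<union> red_nb Q k')" for k k'
  have card_S: "card Q \<le> card (S k k') + (card (red_nb Q h) + card (red_nb Q k) + card (red_nb Q k'))" for k k'
  proof -
    let ?U = "red_nb Q h \<union> red_nb Q k \<union> red_nb Q k'"
    have "card ?U \<le> card (red_nb Q h) + card (red_nb Q k) + card (red_nb Q k')"
      by (meson add_le_mono card_Un_le le_refl le_trans)
    moreover have "card Q - card ?U \<le> card (S k k')"
      unfolding S_def by (rule diff_card_le_card_Diff) (meson Q Un_least finite_subset_V order_trans red_nb_subset)
    ultimately show ?thesis by linarith
  qed
  have "2 \<le> card (S k1 k2)" "2 \<le> card (S k2 k3)" "4 \<le> card (S k3 k4)" "4 \<le> card (S k4 k1)"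
    using card_S[of k1 k2] card_S[of k2 k3] card_S[of k3 k4] card_S[of k4 k1] c by linarith+
  then obtain o1 o2 o3 o4 where y: "o1 \<in> S k1 k2" "o2 \<in> S k2 k3" "o3 \<in> S k3 k4" "o4 \<in> S k4 k1"
    and d: "distinct [o1, o2, o3, o4]"
    using ex_distinct_representatives4 by blast
  have S: "y \<in> Q \<and> B h y \<and> B k y \<and> B y k'"
    if "y \<in> S k k'" "h \<notin> Q" "k \<notin> Q" "k' \<notin> Q" for y k k'
    using that by (auto simp: S_def red_nb_def B_def R_commute)
  have kQ: "h \<notin> Q" "k1 \<notin> Q" "k2 \<notin> Q" "k3 \<notin> Q" "k4 \<notin> Q"
    using ks by auto
  have o': "o1 \<in> Q \<and> B h o1 \<and> B k1 o1 \<and> B o1 k2" "o2 \<in> Q \<and> B h o2 \<and> B k2 o2 \<and> B o2 k3"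
    "o3 \<in> Q \<and> B h o3 \<and> B k3 o3 \<and> B o3 k4" "o4 \<in> Q \<and> B h o4 \<and> B k4 o4 \<and> B o4 k1"
    using y S kQ by blast+
  then have "distinct [h, k1, o1, k2, o2, k3, o3, k4, o4]"
    using ks(1) d kQ by auto
  then show ?thesis
    by (rule wheelI) (use ks B o' Q in auto)
qed

text \<open>Inside the blue neighbourhoods of \<open>w\<close> no red edge disturbs
  \<open>wheel_alternating\<close>: the hub is \<open>w\<close> and the rim alternates between the
  sides. The vertex \<open>w\<close> may lie in either side or in neither.\<close>

lemma wheel_bipartite:
  assumes "X \<subseteq> V" "Q \<subseteq> V" "X \<inter> Q = {}" "\<And>x y. x \<in> X \<Longrightarrow> y \<in> Q \<Longrightarrow> B x y"
    and w: "w \<in> V" "4 \<le> card (blue_nb X w)" "4 \<le> card (blue_nb Q w)"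
  shows has_wheel
proof -
  obtain k1 k2 k3 k4 where k: "{k1, k2, k3, k4} \<subseteq> blue_nb X w" "distinct [k1, k2, k3, k4]"
    using ex_four[OF w(2)] by blast
  have r: "red_nb (blue_nb Q w) x = {}" if "x \<in> {w, k1, k2, k3, k4}" for x
    using that k(1) assms(4) by (auto simp: red_nb_def blue_nb_def B_def)
  show ?thesis
    by (rule wheel_alternating[of "blue_nb Q w" w k1 k2 k3 k4])
      (use k assms r in \<open>auto simp: blue_nb_def B_irrefl\<close>)
qed

subsection \<open>Blue paths on seven vertices\<close>

text \<open>In the common blue neighbourhood of a blue edge \<open>uv\<close>, such a path closes
  through \<open>u\<close> to a rim with hub \<open>v\<close>.\<close>

definition blue_path7 :: "'a set \<Rightarrow> bool" where
  "blue_path7 S \<longleftrightarrow> (\<exists>x1 x2 x3 x4 x5 x6 x7. distinct [x1, x2, x3, x4, x5, x6, x7] \<and>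
     {x1, x2, x3, x4, x5, x6, x7} \<subseteq> S \<and>
     B x1 x2 \<and> B x2 x3 \<and> B x3 x4 \<and> B x4 x5 \<and> B x5 x6 \<and> B x6 x7)"

lemma blue_path7I:
  assumes "distinct [x1, x2, x3, x4, x5, x6, x7]" "{x1, x2, x3, x4, x5, x6, x7} \<subseteq> S"
    "B x1 x2" "B x2 x3" "B x3 x4" "B x4 x5" "B x5 x6" "B x6 x7"
  shows "blue_path7 S"
  unfolding blue_path7_def using assms by (intro exI conjI) assumption+

text \<open>When a path on six vertices is prolonged at an end, the five other vertices are
  forbidden; blue degree six always allows this last step to seven vertices.\<close>

definition high :: "'a set \<Rightarrow> 'a set" where "high S = {x \<in> S. 6 \<le> card (blue_nb S x)}"

definition low :: "'a set \<Rightarrow> 'a set" where "low S = {x \<in> S. card (blue_nb S x) \<le> 5}"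

lemma high_low: "high S \<union> low S = S" "high S \<inter> low S = {}"
  by (auto simp: high_def low_def)

definition path4 :: "'a set \<Rightarrow> 'a \<Rightarrow> 'a \<Rightarrow> 'a \<Rightarrow> 'a \<Rightarrow> bool" where
  "path4 S w1 w2 w3 w4 \<longleftrightarrow> distinct [w1, w2, w3, w4] \<and> {w1, w2, w3, w4} \<subseteq> high S \<and>
     B w1 w2 \<and> B w2 w3 \<and> B w3 w4"

lemma path4_rev: "path4 S w1 w2 w3 w4 \<Longrightarrow> path4 S w4 w3 w2 w1"
  by (auto simp: path4_def B_commute)

lemma high_extend:
  assumes "w \<in> high S" "length xs \<le> 5"
  shows "\<exists>x\<in>S. B w x \<and> x \<notin> set xs"
  using ex_not_in_list[of xs "blue_nb S w"] assms by (auto simp: high_def blue_nb_def)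

text \<open>A high neighbour \<open>a\<close> of \<open>w1\<close> off the path would lead to the
  path \<open>c a w1 w2 w3 w4 b\<close>, where \<open>a\<close> and \<open>w4\<close> are high and
  can be prolonged freely. At most three of the six or more blue neighbours of \<open>w1\<close> lie
  on the path.\<close>

lemma path4_end:
  assumes S: "S \<subseteq> V" and p: "path4 S w1 w2 w3 w4" and no: "\<not> blue_path7 S"
  shows "blue_nb S w1 - {w2, w3, w4} \<subseteq> low S" "3 \<le> card (blue_nb S w1 - {w2, w3, w4})"
proof -
  have w: "distinct [w1, w2, w3, w4]" "{w1, w2, w3, w4} \<subseteq> high S" "B w1 w2" "B w2 w3" "B w3 w4"
    using p by (auto simp: path4_def)
  show "blue_nb S w1 - {w2, w3, w4} \<subseteq> low S"
  proof (rule ccontr)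
    assume "\<not> ?thesis"
    then obtain a where "a \<in> blue_nb S w1" "a \<notin> {w2, w3, w4}" "a \<notin> low S"
      by blast
    then have a: "a \<in> high S" "B w1 a" "a \<notin> {w2, w3, w4}"
      using high_low(1)[of S] by (auto simp: blue_nb_def)
    obtain b where b: "b \<in> S" "B w4 b" "b \<notin> set [a, w1, w2, w3]"
      using high_extend[of w4 S "[a, w1, w2, w3]"] w by auto
    obtain c where c: "c \<in> S" "B a c" "c \<notin> set [b, w1, w2, w3, w4]"
      using high_extend[of a S "[b, w1, w2, w3, w4]"] a by auto
    have "distinct [c, a, w1, w2, w3, w4, b]"
      using w a b c B_irrefl by auto
    then have "blue_path7 S"
      by (rule blue_path7I) (use w a b c in \<open>auto simp: B_commute high_def\<close>)
    with no show False ..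
  qed
  have "card (blue_nb S w1) - card {w2, w3, w4} \<le> card (blue_nb S w1 - {w2, w3, w4})"
    by (rule diff_card_le_card_Diff) simp
  moreover have "card {w2, w3, w4} \<le> 3"
    by (simp add: card_insert_if)
  moreover have "6 \<le> card (blue_nb S w1)"
    using w by (auto simp: high_def)
  ultimately show "3 \<le> card (blue_nb S w1 - {w2, w3, w4})" by linarith
qed

text \<open>Otherwise \<open>l\<close> fits between \<open>w1\<close> and \<open>w2\<close>, and low
  neighbours of both ends complete the path \<open>l1 w1 l w2 w3 w4 l'\<close>.\<close>

lemma path4_consecutive:
  assumes S: "S \<subseteq> V" and p: "path4 S w1 w2 w3 w4" and no: "\<not> blue_path7 S"
    and l: "l \<in> blue_nb S w1 - {w2, w3, w4}"
  shows "l \<notin> blue_nb S w2"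
proof
  assume l2: "l \<in> blue_nb S w2"
  have w: "distinct [w1, w2, w3, w4]" "{w1, w2, w3, w4} \<subseteq> high S" "B w1 w2" "B w2 w3" "B w3 w4"
    using p by (auto simp: path4_def)
  note e1 = path4_end[OF S p no] and e4 = path4_end[OF S path4_rev[OF p] no]
  have lw: "l \<in> low S" using e1 l by blast
  obtain l1 where l1: "l1 \<in> blue_nb S w1 - {w2, w3, w4}" "l1 \<noteq> l"
    using ex_not_in_list[of "[l]" "blue_nb S w1 - {w2, w3, w4}"] e1 by auto
  obtain l' where l': "l' \<in> blue_nb S w4 - {w3, w2, w1}" "l' \<noteq> l" "l' \<noteq> l1"
    using ex_not_in_list[of "[l, l1]" "blue_nb S w4 - {w3, w2, w1}"] e4 by auto
  have "l1 \<in> low S" "l' \<in> low S"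
    using l1 l' e1 e4 by blast+
  then have "distinct [l1, w1, l, w2, w3, w4, l']"
    using w l l1 l' lw high_low(2)[of S] by auto
  then have "blue_path7 S"
    by (rule blue_path7I) (use w l l1 l' l2 in \<open>auto simp: blue_nb_def B_commute high_def\<close>)
  with no show False ..
qed

text \<open>Otherwise \<open>l\<close> closes the path to a cycle of length five. Cutting the edge
  \<open>w1 w2\<close> and prolonging both ends gives \<open>x w2 w3 w4 l w1 l1\<close>.\<close>

lemma path4_ends:
  assumes S: "S \<subseteq> V" and p: "path4 S w1 w2 w3 w4" and no: "\<not> blue_path7 S"
    and l: "l \<in> blue_nb S w1 - {w2, w3, w4}"
  shows "l \<notin> blue_nb S w4"
proof
  assume l4: "l \<in> blue_nb S w4"
  have w: "distinct [w1, w2, w3, w4]" "{w1, w2, w3, w4} \<subseteq> high S" "B w1 w2" "B w2 w3" "B w3 w4"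
    using p by (auto simp: path4_def)
  note e1 = path4_end[OF S p no]
  have lw: "l \<in> low S" using e1 l by blast
  obtain x where x: "x \<in> S" "B w2 x" "x \<notin> set [w1, w3, w4, l]"
    using high_extend[of w2 S "[w1, w3, w4, l]"] w by auto
  obtain l1 where l1: "l1 \<in> blue_nb S w1 - {w2, w3, w4}" "l1 \<noteq> l" "l1 \<noteq> x"
    using ex_not_in_list[of "[l, x]" "blue_nb S w1 - {w2, w3, w4}"] e1 by auto
  have "l1 \<in> low S"
    using l1 e1 by blast
  then have "distinct [x, w2, w3, w4, l, w1, l1]"
    using w l l1 lw x B_irrefl high_low(2)[of S] by auto
  then have "blue_path7 S"
    by (rule blue_path7I) (use w l l1 l4 x in \<open>auto simp: blue_nb_def B_commute high_def\<close>)
  with no show False ..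
qed

text \<open>So few low vertices force the path vertices to form a blue clique; then the path can be
  reordered, and the preceding lemmas for different orders contradict each other.\<close>

lemma no_path4:
  assumes S: "S \<subseteq> V" and no: "\<not> blue_path7 S" and few: "card (low S) \<le> 6"
  shows "\<not> path4 S w1 w2 w3 w4"
proof
  assume p: "path4 S w1 w2 w3 w4"
  have low: "finite (low S)"
    using S finite_subset_V[of "low S"] by (auto simp: low_def)
  \<comment> \<open>The outer neighbourhoods of the two ends are disjoint subsets of
    \<open>low S\<close> with at least three elements each, so they have exactly three and together
    fill \<open>low S\<close>. Degree at least six then makes \<open>x1\<close> adjacent to all
    other path vertices.\<close>
  have full: "path4 S x1 x2 x3 x4 \<Longrightarrow> B x1 x2 \<and> B x1 x3 \<and> B x1 x4 \<and>
      blue_nb S x1 - {x2, x3, x4} \<union> (blue_nb S x4 - {x1, x2, x3}) = low S" for x1 x2 x3 x4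
  proof -
    assume p: "path4 S x1 x2 x3 x4"
    let ?A = "blue_nb S x1 - {x2, x3, x4}" and ?D = "blue_nb S x4 - {x1, x2, x3}"
    note e1 = path4_end[OF S p no] and e4 = path4_end[OF S path4_rev[OF p] no]
    have D: "blue_nb S x4 - {x3, x2, x1} = ?D" by blast
    have dis: "?A \<inter> ?D = {}"
      using path4_ends[OF S p no] by blast
    have sub: "?A \<union> ?D \<subseteq> low S"
      using e1 e4 by blast
    have fin: "finite ?A" "finite ?D"
      using sub low finite_subset by blast+
    have c: "card (?A \<union> ?D) = card ?A + card ?D"
      by (rule card_Un_disjoint[OF fin dis])
    moreover have "card (?A \<union> ?D) \<le> card (low S)"
      by (rule card_mono[OF low sub])
    moreover have "3 \<le> card ?D"
      using e4(2) unfolding D .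
    ultimately have cA: "card ?A = 3" "card ?D = 3"
      using e1(2) few by linarith+
    have un: "?A \<union> ?D = low S"
      by (rule card_seteq[OF low sub]) (use cA c few in linarith)
    have "x1 \<in> high S"
      using p by (simp add: path4_def)
    then have "6 \<le> card (blue_nb S x1)"
      by (simp add: high_def)
    moreover have "card (blue_nb S x1) \<le> card (?A \<union> (blue_nb S x1 \<inter> {x2, x3, x4}))"
      by (rule card_mono) (use fin in auto)
    moreover have "\<dots> \<le> card ?A + card (blue_nb S x1 \<inter> {x2, x3, x4})"
      by (rule card_Un_le)
    ultimately have "3 \<le> card (blue_nb S x1 \<inter> {x2, x3, x4})"
      using cA by linarith
    moreover have "card {x2, x3, x4} \<le> 3"
      by (simp add: card_insert_if)
    ultimately have "blue_nb S x1 \<inter> {x2, x3, x4} = {x2, x3, x4}"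
      by (intro card_seteq) auto
    then show ?thesis
      using un by (auto simp: blue_nb_def)
  qed
  have w: "distinct [w1, w2, w3, w4]" "{w1, w2, w3, w4} \<subseteq> high S" "B w1 w2" "B w2 w3" "B w3 w4"
    using p by (auto simp: path4_def)
  note f1 = full[OF p] and f4 = full[OF path4_rev[OF p]]
  have e: "B w2 w1" "B w1 w4" "B w4 w3" "B w1 w3" "B w3 w2" "B w2 w4"
    using f1 f4 w B_sym[of w1 w2] B_sym[of w3 w4] B_sym[of w2 w3] B_sym[of w4 w2] by simp_all
  \<comment> \<open>An outer neighbour \<open>l\<close> of \<open>w2\<close> is low by
    \<open>p2\<close>. Along the given path it cannot be adjacent to \<open>w1\<close>, so it is
    adjacent to \<open>w4\<close>; but in the reverse of \<open>p3\<close> the vertex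
    \<open>w2\<close> follows \<open>w4\<close>, which forbids adjacency to both.\<close>
  have p2: "path4 S w2 w1 w4 w3" and p3: "path4 S w1 w3 w2 w4"
    using w(1,2) e unfolding path4_def by auto
  obtain l where l: "l \<in> blue_nb S w2 - {w1, w4, w3}"
    using path4_end(2)[OF S p2 no] by (metis card.empty equals0I not_numeral_le_zero)
  then have "l \<in> low S" "l \<in> blue_nb S w2"
    using path4_end(1)[OF S p2 no] by blast+
  moreover have "l \<notin> blue_nb S w1 - {w2, w3, w4}"
    using path4_consecutive[OF S p no] l by blast
  ultimately have "l \<in> blue_nb S w4 - {w1, w2, w3}"
    using f1 by (metis Un_iff)
  then have "l \<notin> blue_nb S w2"
    using path4_consecutive[OF S path4_rev[OF p3] no] by blast
  with l show False by blast
qed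

text \<open>Two of the vertices share at least 4 + 4 - 6 low neighbours, so low vertices can be
  threaded between and around the three: \<open>l1 x l2 y l3 z l4\<close>.\<close>

lemma three_highs:
  assumes S: "S \<subseteq> V" and no: "\<not> blue_path7 S" and few: "card (low S) \<le> 6"
    and xyz: "distinct [x, y, z]" "{x, y, z} \<subseteq> high S"
    and c: "4 \<le> card (blue_nb (low S) x)" "4 \<le> card (blue_nb (low S) y)" "4 \<le> card (blue_nb (low S) z)"
  shows False
proof -
  have low: "finite (low S)"
    using S finite_subset_V[of "low S"] by (auto simp: low_def)
  have two: "2 \<le> card (blue_nb (low S) u \<inter> blue_nb (low S) w)"
    if "4 \<le> card (blue_nb (low S) u)" "4 \<le> card (blue_nb (low S) w)" for u w
  proof -
    have "finite (blue_nb (low S) u)" "finite (blue_nb (low S) w)"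
      using low blue_nb_subset finite_subset by metis+
    then have "card (blue_nb (low S) u) + card (blue_nb (low S) w) =
        card (blue_nb (low S) u \<union> blue_nb (low S) w) + card (blue_nb (low S) u \<inter> blue_nb (low S) w)"
      by (rule card_Un_Int)
    moreover have "card (blue_nb (low S) u \<union> blue_nb (low S) w) \<le> 6"
      by (meson Un_least blue_nb_subset card_mono few le_trans low)
    ultimately show ?thesis using that by linarith
  qed
  obtain l2 where l2: "l2 \<in> blue_nb (low S) x \<inter> blue_nb (low S) y"
    using two[OF c(1,2)] ex_not_in_list[of "[]" "blue_nb (low S) x \<inter> blue_nb (low S) y"] by auto
  obtain l3 where l3: "l3 \<in> blue_nb (low S) y \<inter> blue_nb (low S) z" "l3 \<noteq> l2"
    using ex_not_in_list[of "[l2]" "blue_nb (low S) y \<inter> blue_nb (low S) z"] two[OF c(2,3)] by auto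
  obtain l1 where l1: "l1 \<in> blue_nb (low S) x" "l1 \<noteq> l2" "l1 \<noteq> l3"
    using ex_not_in_list[of "[l2, l3]" "blue_nb (low S) x"] c by auto
  obtain l4 where l4: "l4 \<in> blue_nb (low S) z" "l4 \<noteq> l2" "l4 \<noteq> l3" "l4 \<noteq> l1"
    using ex_not_in_list[of "[l2, l3, l1]" "blue_nb (low S) z"] c by auto
  have "{l1, l2, l3, l4} \<subseteq> low S"
    using l1 l2 l3 l4 by (auto simp: blue_nb_def)
  then have "distinct [l1, x, l2, y, l3, z, l4]"
    using xyz l1 l2 l3 l4 high_low(2)[of S] by auto
  then have "blue_path7 S"
    by (rule blue_path7I) (use xyz l1 l2 l3 l4 in \<open>auto simp: blue_nb_def B_commute high_def low_def\<close>)
  with no show False ..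
qed

lemma card_blue_nb_high_low:
  assumes "S \<subseteq> V"
  shows "card (blue_nb S x) = card (blue_nb (high S) x) + card (blue_nb (low S) x)"
  using card_blue_nb_Un[of "high S" "low S" x] high_low[of S] assms by auto

text \<open>With at most six low vertices there are at least three high ones, and three of them
  would have four low neighbours each, against \<open>three_highs\<close>. Any three will do if all
  high vertices have at most two high neighbours; otherwise three high neighbours of one vertex
  \<open>w\<close> are taken.\<close>

lemma many_low:
  assumes S: "S \<subseteq> V" and no: "\<not> blue_path7 S" and c: "9 \<le> card S"
  shows "7 \<le> card (low S)"
proof (rule ccontr)
  assume "\<not> ?thesis"
  then have few: "card (low S) \<le> 6" by simp
  have fin: "finite (low S)" "finite (high S)"
    using S finite_subset_V[of "low S"] finite_subset_V[of "high S"] by (auto simp: low_def high_def)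
  have "card S = card (high S) + card (low S)"
    using card_Un_disjoint[OF fin(2,1) high_low(2)] by (simp only: high_low(1))
  then have h3: "3 \<le> card (high S)"
    using c few by linarith
  have lows: "6 \<le> card (blue_nb (high S) x) + card (blue_nb (low S) x)" if "x \<in> high S" for x
    unfolding card_blue_nb_high_low[OF S, symmetric] using that by (simp add: high_def)
  have "\<exists>x y z. distinct [x, y, z] \<and> {x, y, z} \<subseteq> high S \<and> 4 \<le> card (blue_nb (low S) x) \<and>
      4 \<le> card (blue_nb (low S) y) \<and> 4 \<le> card (blue_nb (low S) z)"
  proof (cases "\<forall>x\<in>high S. card (blue_nb (high S) x) \<le> 2")
    case True
    have "4 \<le> card (blue_nb (low S) x)" if "x \<in> high S" for x
      using lows[OF that] bspec[OF True that] by linarith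
    moreover obtain x y z where "{x, y, z} \<subseteq> high S" "distinct [x, y, z]"
      using ex_three[OF h3] by blast
    ultimately show ?thesis
      by (intro exI[of _ x] exI[of _ y] exI[of _ z]) simp
  next
    case False
    then obtain w where w: "w \<in> high S" "3 \<le> card (blue_nb (high S) w)"
      by (metis Suc_le_eq linorder_not_less numeral_2_eq_2 numeral_3_eq_3)
    obtain p q r where pqr: "distinct [p, q, r]" "{p, q, r} \<subseteq> blue_nb (high S) w"
      using ex_three[OF w(2)] by blast
    have "4 \<le> card (blue_nb (low S) x)" if x: "x \<in> {p, q, r}" for x
    proof -
      \<comment> \<open>A further high neighbour \<open>s\<close> would give the excluded path
        \<open>s x w t\<close>, where \<open>t\<close> is another of the three neighbours of
        \<open>w\<close>.\<close>
      have "blue_nb (high S) x \<subseteq> {w}"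
      proof (rule ccontr)
        assume "\<not> ?thesis"
        then obtain s where s: "s \<in> high S" "B x s" "s \<noteq> w"
          by (auto simp: blue_nb_def)
        obtain t where t: "t \<in> {p, q, r}" "t \<noteq> x" "t \<noteq> s"
          using pqr(1) by auto
        have "x \<in> blue_nb (high S) w" "t \<in> blue_nb (high S) w"
          using subsetD[OF pqr(2)] x t(1) by simp_all
        then have "path4 S s x w t"
          using s t w(1) B_irrefl by (auto simp: path4_def blue_nb_def B_commute)
        then show False
          using no_path4[OF S no few] by blast
      qed
      then have "card (blue_nb (high S) x) \<le> 1"
        using card_mono[of "{w}" "blue_nb (high S) x"] by simp
      moreover have "x \<in> high S"
        using x pqr by (auto simp: blue_nb_def)
      ultimately show ?thesis
        using lows[of x] by linarith
    qed
    moreover have "{p, q, r} \<subseteq> high S"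
      using pqr(2) blue_nb_subset by (rule subset_trans)
    ultimately show ?thesis
      using pqr(1) by (intro exI[of _ p] exI[of _ q] exI[of _ r]) simp
  qed
  then show False
    using three_highs[OF S no few] by blast
qed

subsection \<open>Sides of small blue degree\<close>

lemma treeI_leaves:
  assumes "distinct [v, a1, b1, c1, a2, b2, c2]" "{v, a1, b1, c1, a2, b2, c2} \<subseteq> V"
    "R v a1" "R a1 b1" "R b1 c1" "R v a2" "R a2 b2" "R b2 c2"
    and L: "L \<subseteq> V" "\<And>l. l \<in> L \<Longrightarrow> R v l \<and> l \<notin> {a1, b1, c1, a2, b2, c2}" "n - 7 \<le> card L"
  shows has_tree
proof (rule treeI[OF assms(1-8)])
  have "L \<subseteq> red_nb V v - {a1, b1, c1, a2, b2, c2}"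
    using L by (auto simp: red_nb_def)
  then have "card L \<le> card (red_nb V v - {a1, b1, c1, a2, b2, c2})"
    by (rule card_mono[rotated]) (simp add: finite_subset_V red_nb_subset)
  with L(3) show "n - 7 \<le> card (red_nb V v - {a1, b1, c1, a2, b2, c2})"
    by linarith
qed

end

locale counterexample = red_blue +
  assumes n8: "8 \<le> n" and no_tree: "\<not> has_tree" and no_wheel: "\<not> has_wheel"
begin

lemma card_Diff_set_ge: "finite S \<Longrightarrow> card S - length xs \<le> card (S - set xs)"
  using diff_card_le_card_Diff[of "set xs" S] card_length[of xs] by simp

text \<open>The bound three comes from \<open>wheel_bipartite\<close>: a vertex with four blue
  neighbours in its own side is a hub if the other side is joined to it in blue.\<close>

definition sparse :: "'a set \<Rightarrow> bool" where
  "sparse X \<longleftrightarrow> (\<forall>x\<in>X. card (blue_nb X x) \<le> 3)"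

lemma sparseD: "sparse X \<Longrightarrow> x \<in> X \<Longrightarrow> card (blue_nb X x) \<le> 3"
  by (simp add: sparse_def)

text \<open>The tree spans \<open>X\<close>. Its center \<open>x\<close> can be blue only to
  \<open>d1\<close> and \<open>d2\<close>, which therefore become the middle vertices of the two
  long paths. The neighbours of \<open>d2\<close> are chosen first and cost \<open>d1\<close> up to
  two candidates, hence the bounds four and two.\<close>

lemma center_two_outside:
  assumes X: "X \<subseteq> V" "card X = n" "x \<in> X" "d1 \<in> X" "d2 \<in> X" "distinct [x, d1, d2]"
    and D: "blue_nb X x \<subseteq> {d1, d2}"
    and c: "4 \<le> card (red_nb (X - {x, d1, d2}) d1)" "2 \<le> card (red_nb (X - {x, d1, d2}) d2)"
  shows False
proof -
  let ?W = "X - {x, d1, d2}"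
  obtain a2 c2 where 2: "a2 \<in> red_nb ?W d2" "c2 \<in> red_nb ?W d2" "a2 \<noteq> c2"
    using ex_two[OF c(2)] by blast
  obtain a1 where 1: "a1 \<in> red_nb ?W d1" "a1 \<notin> set [a2, c2]"
    using ex_not_in_list[of "[a2, c2]" "red_nb ?W d1"] c(1) by auto
  obtain c1 where 3: "c1 \<in> red_nb ?W d1" "c1 \<notin> set [a2, c2, a1]"
    using ex_not_in_list[of "[a2, c2, a1]" "red_nb ?W d1"] c(1) by auto
  have W: "R x w" if "w \<in> ?W" for w
    using that D by (auto simp: blue_nb_def B_def)
  have in_W: "a1 \<in> ?W" "c1 \<in> ?W" "a2 \<in> ?W" "c2 \<in> ?W"
    using 1 2 3 by (auto simp: red_nb_def)
  have fin: "finite X" using X finite_subset_V by blast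
  let ?L = "X - set [x, d1, d2, a1, c1, a2, c2]"
  have has_tree
  proof (rule treeI_leaves[of x a1 d1 c1 a2 d2 c2 ?L])
    show "distinct [x, a1, d1, c1, a2, d2, c2]"
      using 1 2 3 X(6) in_W by auto
    show "n - 7 \<le> card ?L"
      using card_Diff_set_ge[OF fin, of "[x, d1, d2, a1, c1, a2, c2]"] X(2) by simp
    show "R x l \<and> l \<notin> {a1, d1, c1, a2, d2, c2}" if "l \<in> ?L" for l
      using that W[of l] by simp
    show "{x, a1, d1, c1, a2, d2, c2} \<subseteq> V" "?L \<subseteq> V"
      using X in_W by auto
  qed (use 1 2 3 W[OF in_W(1)] W[OF in_W(3)] in \<open>auto simp: red_nb_def R_commute\<close>)
  with no_tree show False ..
qed

lemma card_red_nb_Diff_ge: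
  assumes "X \<subseteq> V" "d \<in> X" "set xs \<subseteq> X" "d \<in> set xs" "finite D" "blue_nb X d \<subseteq> D" "card (D - set xs) \<le> k"
  shows "card X \<le> length xs + k + card (red_nb (X - set xs) d)"
proof -
  let ?W = "X - set xs"
  have fin: "finite X" using assms finite_subset_V by blast
  have "card X - length xs \<le> card ?W"
    by (rule card_Diff_set_ge[OF fin])
  moreover have "card ?W = card (red_nb ?W d) + card (blue_nb ?W d)"
    by (rule card_neighbours_notin) (use assms in auto)
  moreover have "blue_nb ?W d \<subseteq> D - set xs"
    using assms by (auto simp: blue_nb_def)
  then have "card (blue_nb ?W d) \<le> card (D - set xs)"
    by (rule card_mono[rotated]) (use assms(5) in simp)
  then have "card (blue_nb ?W d) \<le> k"
    using assms(7) by linarith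
  ultimately show ?thesis by linarith
qed

text \<open>In a tree with center \<open>x\<close> that spans \<open>X\<close>, the three blue
  neighbours of \<open>x\<close> must occupy places away from the center. A red edge
  \<open>d1 d2\<close> would let both lie on one long path, leaving the other path to
  \<open>d3\<close>.\<close>

lemma outside_clique:
  assumes X: "X \<subseteq> V" "card X = n" "x \<in> X"
    and sp: "sparse X"
    and D: "blue_nb X x = {d1, d2, d3}" "distinct [d1, d2, d3]"
  shows "B d1 d2"
proof (rule ccontr)
  note le = sparseD[OF sp]
  assume "\<not> B d1 d2"
  with D have R12: "R d1 d2" by (auto simp: B_def)
  have dX: "{d1, d2, d3} \<subseteq> X" and Bx: "B x d1" "B x d2" "B x d3"
    using D by (auto simp: blue_nb_def)
  have ne: "distinct [x, d1, d2, d3]"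
    using D(2) Bx B_irrefl by auto
  let ?W = "X - set [x, d1, d2, d3]"
  have fin: "finite X" using X finite_subset_V by blast
  have fb: "finite (blue_nb X y)" for y
    using fin blue_nb_subset finite_subset by metis
  \<comment> \<open>One of the at most three blue neighbours of \<open>d\<close> is
    \<open>x\<close>, so at most two lie in \<open>?W\<close>, which has at least
    \<open>n - 4\<close> elements.\<close>
  have r2: "n \<le> 6 + card (red_nb ?W d)" if d: "d \<in> {d1, d2, d3}" for d
  proof -
    have "x \<in> blue_nb X d"
      using Bx d X(3) by (auto simp: blue_nb_def B_commute)
    then have "card (blue_nb X d - {x}) \<le> 2"
      using le[of d] d dX fb[of d] by auto
    moreover have "card (blue_nb X d - set [x, d1, d2, d3]) \<le> card (blue_nb X d - {x})"
      by (rule card_mono) (use fb in auto)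
    ultimately have "card (blue_nb X d - set [x, d1, d2, d3]) \<le> 2" by linarith
    then show ?thesis
      using card_red_nb_Diff_ge[of X d "[x, d1, d2, d3]" "blue_nb X d" 2] X d dX fb[of d] by auto
  qed
  have W: "R x w" if "w \<in> ?W" for w
    using that D by (auto simp: blue_nb_def B_def)
  have cW: "n - 4 \<le> card ?W"
    using card_Diff_set_ge[OF fin, of "[x, d1, d2, d3]"] X(2) by simp
  have tree: False if "{a1, a2} \<subseteq> ?W" "{p, q, r, c2} \<subseteq> X - {x}" "L \<subseteq> ?W"
    "distinct [a1, p, q, a2, r, c2]" "R a1 p" "R p q" "R a2 r" "R r c2"
    "L \<inter> {a1, p, q, a2, r, c2} = {}" "n - 7 \<le> card L" for a1 p q a2 r c2 L
  proof -
    have has_tree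
      by (rule treeI_leaves[of x a1 p q a2 r c2 L]) (use that W X in auto)
    with no_tree show False ..
  qed
  \<comment> \<open>The long paths are \<open>x a1 p q\<close> and
    \<open>x a2 d3 c2\<close>.\<close>
  have path3: False if "a1 \<in> red_nb ?W p" "R p q" "{p, q} = {d1, d2}" "a2 \<in> red_nb ?W d3" "c2 \<in> red_nb ?W d3"
    "a2 \<noteq> c2" "a1 \<noteq> a2" "a1 \<noteq> c2" for a1 p q a2 c2
  proof -
    have "card ?W - 3 \<le> card (?W - {a1, a2, c2})"
      using card_Diff_set_ge[of ?W "[a1, a2, c2]"] fin by simp
    then have c: "n - 7 \<le> card (?W - {a1, a2, c2})"
      using cW by linarith
    have p: "p = d1 \<and> q = d2 \<or> p = d2 \<and> q = d1"
      using that(3) by (auto simp: doubleton_eq_iff)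
    have W: "a1 \<in> ?W" "a2 \<in> ?W" "c2 \<in> ?W" and R: "R a1 p" "R a2 d3" "R d3 c2"
      using that(1,4,5) by (auto simp: red_nb_def R_commute)
    have "distinct [a1, p, q, a2, d3, c2]"
      using p that(6-8) ne W by auto
    then show False
      by (rule tree[where L = "?W - {a1, a2, c2}", rotated 3]) (use R that(2) W p ne dX c in auto)
  qed
  obtain p q where pq: "p \<in> red_nb ?W d3" "q \<in> red_nb ?W d3" "p \<noteq> q"
    using ex_two[of "red_nb ?W d3"] r2[of d3] n8 by auto
  show False
  proof (cases "red_nb ?W d1 \<union> red_nb ?W d2 \<union> red_nb ?W d3 \<subseteq> {p, q}")
    case False
    then obtain a where a: "a \<notin> {p, q}" "a \<in> red_nb ?W d1 \<or> a \<in> red_nb ?W d2 \<or> a \<in> red_nb ?W d3"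
      by blast
    have R21: "R d2 d1" using R12 R_commute by blast
    have *: "a' \<notin> {p', q'} \<Longrightarrow> p' \<in> red_nb ?W d3 \<Longrightarrow> q' \<in> red_nb ?W d3 \<Longrightarrow> p' \<noteq> q' \<Longrightarrow>
       a' \<in> red_nb ?W d1 \<or> a' \<in> red_nb ?W d2 \<Longrightarrow> False" for a' p' q'
      using path3[of a' d1 d2 p' q'] path3[of a' d2 d1 p' q'] R12 R21 by blast
    show False
    proof (cases "a \<in> red_nb ?W d1 \<or> a \<in> red_nb ?W d2")
      case True
      then show False using * a(1) pq by blast
    next
      case False
      then have a3: "a \<in> red_nb ?W d3" using a by blast
      obtain a' where a': "a' \<in> red_nb ?W d1"
        using ex_not_in_list[of "[]" "red_nb ?W d1"] r2[of d1] n8 by auto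
      \<comment> \<open>Now \<open>d3\<close> has the three candidates \<open>a\<close>,
        \<open>p\<close>, \<open>q\<close>, and two of them differ from \<open>a'\<close>.\<close>
      show False
        using *[of a' p q] *[of a' a p] *[of a' a q] a a' a3 pq by blast
    qed
  next
    case True
    \<comment> \<open>All three \<open>d\<close>s have the same two red neighbours in
      \<open>?W\<close>. A further vertex \<open>w\<close> is then blue to all of them and, by
      sparseness, red to \<open>q\<close>; the long paths become \<open>x p d1 d2\<close> and
      \<open>x w q d3\<close>.\<close>
    have eq: "red_nb ?W d = {p, q}" if d: "d \<in> {d1, d2, d3}" for d
    proof (rule card_seteq)
      show "card {p, q} \<le> card (red_nb ?W d)"
        using r2[OF d] n8 pq(3) by simp
    qed (use True d in auto)
    have nW: "4 \<le> card ?W" using cW n8 by linarith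
    have pqW: "p \<in> ?W" "q \<in> ?W" using pq by (auto simp: red_nb_def)
    obtain w where w: "w \<in> ?W" "w \<notin> set [p, q]"
      using ex_not_in_list[of "[p, q]" ?W] nW by auto
    have Bw: "B w d" if d: "d \<in> {d1, d2, d3}" for d
    proof -
      have "w \<notin> red_nb ?W d"
        using w(2) unfolding eq[OF d] by simp
      then have "\<not> R d w"
        using w(1) unfolding red_nb_def by blast
      moreover have "w \<noteq> d"
        using w(1) d by auto
      ultimately show ?thesis
        using R_sym unfolding B_def by blast
    qed
    have "blue_nb X w = {d1, d2, d3}"
    proof (rule card_seteq[symmetric])
      show "card (blue_nb X w) \<le> card {d1, d2, d3}"
        using le[of w] w ne by auto
    qed (use Bw dX fb in \<open>auto simp: blue_nb_def\<close>)
    then have Rwq: "R w q"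
      using w pqW by (auto simp: blue_nb_def B_def)
    have qd: "R q d3" "R p d1"
    proof -
      have "q \<in> red_nb ?W d3" "p \<in> red_nb ?W d1"
        using eq[of d3] eq[of d1] by simp_all
      then show "R q d3" "R p d1"
        using R_sym unfolding red_nb_def by blast+
    qed
    have "card ?W - 3 \<le> card (?W - {p, w, q})"
      using card_Diff_set_ge[of ?W "[p, w, q]"] fin by simp
    then have c: "n - 7 \<le> card (?W - {p, w, q})"
      using cW by linarith
    have R: "R p d1" "R w q" "R q d3"
      using qd Rwq by auto
    have "distinct [p, d1, d2, w, q, d3]"
      using w pq(3) ne pqW by auto
    then show False
      by (rule tree[where L = "?W - {p, w, q}", rotated 3])
        (use R R12 w(1) pqW ne dX c in auto)
  qed
qed

lemma finite_blue_nb: "X \<subseteq> V \<Longrightarrow> finite (blue_nb X x)"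
  using finite_subset_V[of "blue_nb X x"] blue_nb_subset[of X x] by blast

lemma finite_red_nb: "X \<subseteq> V \<Longrightarrow> finite (red_nb X x)"
  using finite_subset_V[of "red_nb X x"] red_nb_subset[of X x] by blast

lemma blue_three_clique:
  assumes X: "X \<subseteq> V" "card X = n" "x \<in> X"
    and sp: "sparse X"
    and three: "card (blue_nb X x) = 3" and d: "d \<in> blue_nb X x" "d' \<in> blue_nb X x" "d \<noteq> d'"
  shows "B d d'"
proof -
  obtain d3 where d3: "d3 \<in> blue_nb X x" "d3 \<notin> set [d, d']"
    using ex_not_in_list[of "[d, d']" "blue_nb X x"] three by auto
  have "{d, d', d3} = blue_nb X x"
    by (rule card_seteq) (use d d3 three finite_blue_nb[OF X(1)] in auto)
  then show ?thesis
    using outside_clique[OF X sp, of d d' d3] d d3 by auto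
qed

text \<open>A vertex \<open>x\<close> of blue degree at most two would be the center of a red
  spanning tree by \<open>center_two_outside\<close>. The work is to choose the two middle vertices
  so that they keep enough red neighbours.\<close>

lemma blue_degree_three:
  assumes X: "X \<subseteq> V" "card X = n" and sp: "sparse X"
    and x: "x \<in> X"
  shows "card (blue_nb X x) = 3"
proof (rule ccontr)
  note le = sparseD[OF sp]
  assume "card (blue_nb X x) \<noteq> 3"
  then have small: "card (blue_nb X x) \<le> 2" using le[OF x] by simp
  have fin: "finite X" using X finite_subset_V by blast
  note fb = finite_blue_nb[OF X(1)]
  have cases: "card (blue_nb X y) \<le> 2 \<or> card (blue_nb X y) = 3" if "y \<in> X" for y
    using le[OF that] by linarith
  note clique = blue_three_clique[OF X _ sp]
  \<comment> \<open>If \<open>y\<close> had degree three, its closed neighbourhood would be a blue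
    clique containing \<open>z\<close>, and \<open>z\<close> would have degree three as
    well.\<close>
  have nbr: "card (blue_nb X y) \<le> 2" if z: "z \<in> X" "card (blue_nb X z) \<le> 2" and y: "y \<in> blue_nb X z" for y z
  proof (rule ccontr)
    assume neg: "\<not> ?thesis"
    have yX: "y \<in> X" using y blue_nb_subset by blast
    with neg have y3: "card (blue_nb X y) = 3" using cases by blast
    have zy: "z \<in> blue_nb X y" using y z by (auto simp: blue_nb_def B_commute)
    have "blue_nb X y - {z} \<union> {y} \<subseteq> blue_nb X z"
      using y clique[OF yX y3 zy] by (auto simp: blue_nb_def)
    then have "card (blue_nb X y - {z} \<union> {y}) \<le> card (blue_nb X z)"
      by (rule card_mono[OF fb])
    moreover have "y \<notin> blue_nb X y - {z}" by (simp add: blue_nb_def B_irrefl)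
    then have "card (blue_nb X y - {z} \<union> {y}) = 3"
      using y3 zy fb[of y] by simp
    ultimately show False using z(2) by simp
  qed
  have deg: "n \<le> 3 + k + card (red_nb (X - {x, d1, d2}) d)"
    if "distinct [x, d1, d2]" "{d1, d2} \<subseteq> X" "d \<in> {d1, d2}" "card (blue_nb X d - {x, d1, d2}) \<le> k" for d d1 d2 k
    using card_red_nb_Diff_ge[of X d "[x, d1, d2]" "blue_nb X d" k] that X x fb by auto
  have rest: "card (blue_nb X d - {x, d1, d2}) \<le> card (blue_nb X d - S)"
    if "S \<subseteq> {x, d1, d2}" for d d1 d2 S
    by (rule card_mono) (use that fb in auto)
  have le3: "card (blue_nb X d - {x, d1, d2}) \<le> 3" if "d \<in> X" for d d1 d2
    using rest[of "{}" d1 d2 d] le[OF that] by simp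
  \<comment> \<open>For n at least 8, \<open>d1\<close> keeps at least n - 3 - 1 and
    \<open>d2\<close> at least n - 3 - 3 red neighbours, which are the required four and
    two.\<close>
  have use_pair: False
    if "distinct [x, d1, d2]" "{d1, d2} \<subseteq> X" "blue_nb X x \<subseteq> {d1, d2}" "card (blue_nb X d1 - {x, d1, d2}) \<le> 1" for d1 d2
    by (rule center_two_outside[OF X x, of d1 d2])
      (use that deg[OF that(1,2), of d1 1] deg[OF that(1,2), of d2 3] le3[of d2 d1 d2] n8 in auto)
  have xb: "x \<notin> blue_nb X x" by (simp add: blue_nb_def B_irrefl)
  show False
  proof (cases "blue_nb X x = {}")
    case False
    then obtain d1 where d1: "d1 \<in> blue_nb X x" by blast
    have "card (blue_nb X x - {d1}) \<le> 1"
      using small d1 fb by simp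
    then obtain d2 where d2: "d2 \<in> X - {x, d1}" "blue_nb X x \<subseteq> {d1, d2}"
    proof (cases "blue_nb X x - {d1} = {}")
      case True
      obtain d2 where "d2 \<in> X" "d2 \<notin> set [x, d1]"
        using ex_not_in_list[of "[x, d1]" X] X n8 by auto
      with True that show ?thesis by auto
    next
      case False
      then obtain d2 where "blue_nb X x - {d1} = {d2}"
        using \<open>card (blue_nb X x - {d1}) \<le> 1\<close> fb
        by (metis card_1_singletonE card_0_eq finite_Diff le_antisym less_one not_le)
      with that[of d2] xb blue_nb_subset[of X x] show ?thesis by auto
    qed
    have "x \<in> blue_nb X d1" using d1 x by (auto simp: blue_nb_def B_commute)
    then have "card (blue_nb X d1 - {x}) \<le> 1"
      using nbr[OF x small d1] fb by simp
    then show False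
      using rest[of "{x}" d1 d2 d1] use_pair[of d1 d2] d1 d2 xb blue_nb_subset[of X x] by auto
  next
    case True
    then have nx: "x \<notin> blue_nb X y" if "y \<in> X" for y
      using that unfolding blue_nb_def using B_sym by blast
    show False
    proof (cases "\<exists>d1\<in>X - {x}. card (blue_nb X d1) \<le> 2")
      case True
      then obtain d1 where d1: "d1 \<in> X - {x}" "card (blue_nb X d1) \<le> 2" by blast
      show False
      proof (cases "blue_nb X d1 = {}")
        case True
        obtain d2 where "d2 \<in> X" "d2 \<notin> set [x, d1]"
          using ex_not_in_list[of "[x, d1]" X] X n8 by auto
        then show False
          using use_pair[of d1 d2] True d1 \<open>blue_nb X x = {}\<close> by auto
      next
        case False
        then obtain d2 where d2: "d2 \<in> blue_nb X d1" by blast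
        then have "card (blue_nb X d1 - {d2}) \<le> 1" using d1 fb by simp
        moreover have "d2 \<in> X" "d2 \<noteq> x" "d2 \<noteq> d1"
          using d2 nx[of d1] d1 B_irrefl by (auto simp: blue_nb_def)
        ultimately show False
          using rest[of "{d2}" d1 d2 d1] use_pair[of d1 d2] d1 \<open>blue_nb X x = {}\<close> by auto
      qed
    next
      case False
      then have all3: "card (blue_nb X y) = 3" if "y \<in> X - {x}" for y
        using that cases by blast
      obtain d1 where d1: "d1 \<in> X" "d1 \<noteq> x"
        using ex_not_in_list[of "[x]" X] X n8 by auto
      have c1: "card (blue_nb X d1) = 3" using all3 d1 by blast
      obtain d2 where d2: "d2 \<in> blue_nb X d1" using c1 by fastforce
      have d2X: "d2 \<in> X" "d2 \<noteq> x" "d2 \<noteq> d1"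
        using d2 nx[of d1] d1 B_irrefl by (auto simp: blue_nb_def)
      have two: "card (blue_nb X d1 - {d2}) \<le> 2" using c1 d2 fb by simp
      have c2: "card (blue_nb X d2) = 3" using all3 d2X by blast
      have "d1 \<in> blue_nb X d2" using d1 d2 by (auto simp: blue_nb_def B_commute)
      then have two': "card (blue_nb X d2 - {d1}) \<le> 2" using c2 fb by simp
      \<comment> \<open>All vertices but \<open>x\<close> now have degree three. For n at least 9
        the blue neighbours \<open>d1\<close> and \<open>d2\<close> lose at most two further
        vertices each, so both keep four red neighbours.\<close>
      have "n < 9"
      proof (rule ccontr)
        assume "\<not> n < 9"
        then show False
          using center_two_outside[OF X x d1(1) d2X(1)] deg[of d1 d2 d1 2] deg[of d1 d2 d2 2]
            rest[of "{d2}" d1 d2 d1] rest[of "{d1}" d1 d2 d2] two two' d1 d2X \<open>blue_nb X x = {}\<close> by auto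
      qed
      \<comment> \<open>For n = 8 there is no room: \<open>x\<close> and two disjoint blue cliques
        of order four make nine vertices.\<close>
      let ?K = "insert d1 (blue_nb X d1)"
      have cK: "card ?K = 4" using c1 fb[of d1] B_irrefl by (simp add: blue_nb_def)
      have "card (insert x ?K) \<le> 5" using cK fb[of d1] by (simp add: card_insert_if)
      then have "\<not> X \<subseteq> insert x ?K"
        using card_mono[of "insert x ?K" X] fb[of d1] X(2) n8 by auto
      then obtain y where y: "y \<in> X" "y \<noteq> x" "y \<notin> ?K" by blast
      have cy: "card (blue_nb X y) = 3" using all3 y by blast
      have KX: "?K \<subseteq> X" using d1 blue_nb_subset by blast
      have dis: "z \<notin> blue_nb X y" if z: "z \<in> ?K" for z
      proof
        assume zy: "z \<in> blue_nb X y"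
        then have yz: "y \<in> blue_nb X z" using y by (auto simp: blue_nb_def B_commute)
        then have "z \<noteq> d1" using y by blast
        with z have z1: "z \<in> blue_nb X d1" by blast
        have "insert y (?K - {z}) \<subseteq> blue_nb X z"
          using yz clique[OF d1(1) c1, of z] z1 KX \<open>z \<noteq> d1\<close> by (auto simp: blue_nb_def B_commute)
        then have "card (insert y (?K - {z})) \<le> card (blue_nb X z)"
          by (rule card_mono[OF fb])
        moreover have "card (insert y (?K - {z})) = 4"
          using cK z y fb[of d1] by simp
        ultimately show False
          using le[of z] z KX by fastforce
      qed
      have "insert x ?K \<union> insert y (blue_nb X y) \<subseteq> X"
        using x y KX blue_nb_subset by blast
      then have "card (insert x ?K \<union> insert y (blue_nb X y)) \<le> n"
        using card_mono[OF fin] X(2) by blast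
      moreover have "insert x ?K \<inter> insert y (blue_nb X y) = {}"
        using y dis nx by auto
      then have "card (insert x ?K \<union> insert y (blue_nb X y)) = card (insert x ?K) + card (insert y (blue_nb X y))"
        by (rule card_Un_disjoint[rotated 2]) (use fb in auto)
      moreover have "x \<notin> ?K" using nx d1 by blast
      then have "card (insert x ?K) = 5" using cK fb[of d1] by simp
      moreover have "card (insert y (blue_nb X y)) = 4"
        using cy fb[of y] B_irrefl by (simp add: blue_nb_def)
      ultimately show False using \<open>n < 9\<close> by linarith
    qed
  qed
qed

text \<open>Deleting surplus vertices keeps a side sparse. If \<open>x\<close> has a blue neighbour,
  one of them can be deleted; then \<open>x\<close> has degree at most two in a side of
  \<open>n\<close> vertices, against \<open>blue_degree_three\<close>.\<close>

lemma card_blue_sparse: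
  assumes X: "X \<subseteq> V" "n \<le> card X" and sp: "sparse X"
  shows "card X = n"
proof (rule ccontr)
  note le = sparseD[OF sp]
  assume "card X \<noteq> n"
  with X have big: "n < card X" by simp
  obtain x where x: "x \<in> X" using ex_not_in_list[of "[]" X] big by auto
  obtain y where y: "y \<in> X" "y \<noteq> x" "blue_nb X x \<noteq> {} \<longrightarrow> y \<in> blue_nb X x"
  proof (cases "blue_nb X x = {}")
    case True
    obtain y where "y \<in> X" "y \<notin> set [x]" using ex_not_in_list[of "[x]" X] big n8 by auto
    with True that show ?thesis by auto
  next
    case False
    then show ?thesis using that B_irrefl by (auto simp: blue_nb_def)
  qed
  have fin: "finite X" using X finite_subset_V by blast
  have "n - 1 \<le> card (X - {x, y})"
    using card_Diff_set_ge[OF fin, of "[x, y]"] big by simp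
  then obtain T where T: "T \<subseteq> X - {x, y}" "card T = n - 1" "finite T"
    using obtain_subset_with_card_n by metis
  let ?T = "insert x T"
  have sub: "?T \<subseteq> X" using T x by blast
  have "x \<notin> T" using T by blast
  then have cT: "card ?T = n" using T(2,3) n8 by simp
  have "sparse ?T"
    unfolding sparse_def using card_blue_nb_mono[OF sub X(1)] le sub by (meson le_trans subsetD)
  moreover have "?T \<subseteq> V" using sub X by blast
  ultimately have "card (blue_nb ?T x) = 3"
    using blue_degree_three[OF _ cT] by simp
  moreover have "blue_nb ?T x \<subseteq> blue_nb X x - {y}"
    using T y(2) sub by (auto simp: blue_nb_def)
  then have "card (blue_nb ?T x) \<le> card (blue_nb X x - {y})"
    by (rule card_mono[rotated]) (simp add: finite_blue_nb X)
  moreover have "card (blue_nb X x - {y}) \<le> 2"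
    using y(3) le[OF x] finite_blue_nb[OF X(1), of x] by (cases "blue_nb X x = {}") auto
  ultimately show False by simp
qed

text \<open>The closed blue neighbourhoods are cliques of order four and therefore partition
  \<open>X\<close>.\<close>

lemma four_dvd:
  assumes X: "X \<subseteq> V" "card X = n" and sp: "sparse X"
  shows "4 dvd n"
proof -
  have fin: "finite X" using X finite_subset_V by blast
  note three = blue_degree_three[OF X sp]
  note clique = blue_three_clique[OF X _ sp three]
  let ?K = "\<lambda>x. insert x (blue_nb X x)"
  have cK: "card (?K x) = 4" if "x \<in> X" for x
    using three[OF that] finite_blue_nb[OF X(1), of x] B_irrefl by (simp add: blue_nb_def)
  have K_eq: "?K x = ?K y" if x: "x \<in> X" and y: "y \<in> ?K x" for x y
  proof (rule card_seteq[symmetric])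
    have yX: "y \<in> X" using x y blue_nb_subset by blast
    show "?K y \<subseteq> ?K x"
    proof (rule card_seteq[of "?K y" "?K x", THEN equalityD2])
      show "?K x \<subseteq> ?K y"
        using clique[OF x x] y x by (auto simp: blue_nb_def B_commute)
    qed (use cK x yX finite_blue_nb X in auto)
    show "finite (?K x)" using finite_blue_nb X by simp
    show "card (?K x) \<le> card (?K y)" using cK x yX by simp
  qed
  have "\<Union> (?K ` X) = X" using blue_nb_subset by blast
  moreover have "4 * card (?K ` X) = card (\<Union> (?K ` X))"
  proof (rule card_partition)
    show "finite (?K ` X)" "finite (\<Union> (?K ` X))"
      using fin \<open>\<Union> (?K ` X) = X\<close> by simp_all
    show "card c = 4" if "c \<in> ?K ` X" for c using that cK by blast
    show "c \<inter> d = {}" if "c \<in> ?K ` X" "d \<in> ?K ` X" "c \<noteq> d" for c d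
    proof (rule ccontr)
      assume "c \<inter> d \<noteq> {}"
      then obtain z where z: "z \<in> c" "z \<in> d" by blast
      then have "c = ?K z" "d = ?K z" using that K_eq by blast+
      with that show False by simp
    qed
  qed
  ultimately have "4 * card (?K ` X) = n" using X(2) by simp
  then show ?thesis by (metis dvd_triv_left)
qed

text \<open>Both sides are disjoint unions of blue cliques of order four. A red edge between them
  would supply the one leaf that a side lacks for the tree, so all edges between the sides are blue;
  then cliques from both sides lead to a wheel.\<close>

lemma two_sparse_sides:
  assumes XQ: "X \<subseteq> V" "Q \<subseteq> V" "X \<inter> Q = {}" and c: "card X = n" "card Q = n"
    and X: "sparse X" and Q: "sparse Q"
  shows False
proof -
  have fin: "finite X" "finite Q" using XQ finite_subset_V by blast+
  note three = blue_degree_three[OF XQ(1) c(1) X] and threeQ = blue_degree_three[OF XQ(2) c(2) Q]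
  note clique = blue_three_clique[OF XQ(1) c(1) _ X three] and
    cliqueQ = blue_three_clique[OF XQ(2) c(2) _ Q threeQ]
  have cross: "B w z" if w: "w \<in> X" and z: "z \<in> Q" for w z
  proof (rule ccontr)
    assume "\<not> B w z"
    with w z XQ(3) have Rwz: "R w z" by (auto simp: B_def)
    obtain d1 d2 d3 where D: "blue_nb X w = {d1, d2, d3}" "distinct [d1, d2, d3]"
      using three[OF w] by (auto simp: card_3_iff)
    then have dX: "d1 \<in> X" "d2 \<in> X" "B w d1" "B w d2" by (auto simp: blue_nb_def)
    let ?W = "X - set [w, d1, d2, d3]"
    have "4 \<le> card ?W"
      using card_Diff_set_ge[OF fin(1), of "[w, d1, d2, d3]"] c n8 by simp
    then obtain a1 c1 a2 c2 where W: "{a1, c1, a2, c2} \<subseteq> ?W" "distinct [a1, c1, a2, c2]"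
      using ex_four by meson
    have Rw: "R w y" if "y \<in> ?W" for y
      using that D by (auto simp: blue_nb_def B_def)
    have Rd: "R d y" if d: "d \<in> {d1, d2}" and y: "y \<in> ?W" for d y
    proof -
      have dw: "d \<in> blue_nb X w" using d D by blast
      have "w \<in> blue_nb X d"
        using dw w B_sym unfolding blue_nb_def by blast
      moreover have "blue_nb X w - {d} \<subseteq> blue_nb X d"
      proof
        fix y assume y: "y \<in> blue_nb X w - {d}"
        then have "B d y" using clique[OF w w dw, of y] by blast
        then show "y \<in> blue_nb X d" using y by (simp add: blue_nb_def)
      qed
      ultimately have "insert w (blue_nb X w - {d}) \<subseteq> blue_nb X d" by blast
      moreover have "w \<notin> blue_nb X w" by (simp add: blue_nb_def B_irrefl)
      then have "card (insert w (blue_nb X w - {d})) = 3"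
        using three[OF w] dw finite_blue_nb[OF XQ(1), of w] by simp
      moreover have "d \<in> X" using dw blue_nb_subset by blast
      ultimately have "insert w (blue_nb X w - {d}) = blue_nb X d"
        using card_seteq[OF finite_blue_nb[OF XQ(1)], of "insert w (blue_nb X w - {d})" d] three[of d] by simp
      then have "blue_nb X d \<subseteq> {w, d1, d2, d3}" using D(1) by blast
      then have "y \<notin> blue_nb X d" using y by auto
      moreover have "y \<in> X" "y \<noteq> d" using y d by auto
      ultimately show ?thesis unfolding blue_nb_def B_def by blast
    qed
    \<comment> \<open>The middle vertices are \<open>d1\<close> and \<open>d2\<close>. The third
      blue neighbour \<open>d3\<close> of the center is left out and \<open>z\<close> takes its
      place as a leaf: n - 8 + 1 leaves.\<close>
    let ?L = "insert z (X - set [w, d1, d2, d3, a1, c1, a2, c2])"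
    have "z \<notin> X" using z XQ(3) by blast
    then have "card ?L = Suc (card (X - set [w, d1, d2, d3, a1, c1, a2, c2]))"
      using fin by simp
    then have cL: "n - 7 \<le> card ?L"
      using card_Diff_set_ge[OF fin(1), of "[w, d1, d2, d3, a1, c1, a2, c2]"] c by simp
    have in_W: "a1 \<in> ?W" "c1 \<in> ?W" "a2 \<in> ?W" "c2 \<in> ?W" using W(1) by blast+
    have R: "R w a1" "R a1 d1" "R d1 c1" "R w a2" "R a2 d2" "R d2 c2"
      using Rw Rd in_W R_sym by blast+
    have "distinct [w, a1, d1, c1, a2, d2, c2]"
      using W(2) in_W D(2) dX B_irrefl by auto
    moreover have "R w l \<and> l \<notin> {a1, d1, c1, a2, d2, c2}" if "l \<in> ?L" for l
    proof (cases "l = z")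
      case True
      then show ?thesis using Rwz \<open>z \<notin> X\<close> in_W dX by auto
    next
      case False
      with that Rw[of l] show ?thesis by auto
    qed
    ultimately have has_tree
      using R cL XQ z w dX in_W by (intro treeI_leaves[of w a1 d1 c1 a2 d2 c2 ?L]) auto
    with no_tree show False ..
  qed
  obtain h where h: "h \<in> X" using ex_not_in_list[of "[]" X] c n8 by auto
  obtain k1 k2 k3 where K: "blue_nb X h = {k1, k2, k3}" "distinct [k1, k2, k3]"
    using three[OF h] by (auto simp: card_3_iff)
  obtain z1 where z1: "z1 \<in> Q" using ex_not_in_list[of "[]" Q] c n8 by auto
  obtain z2 z3 z4 where Z: "blue_nb Q z1 = {z2, z3, z4}" "distinct [z2, z3, z4]"
    using threeQ[OF z1] by (auto simp: card_3_iff)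
  obtain z5 where z5: "z5 \<in> Q" "z5 \<notin> set [z1, z2, z3, z4]"
    using ex_not_in_list[of "[z1, z2, z3, z4]" Q] c n8 by auto
  have k: "k1 \<in> X" "k2 \<in> X" "k3 \<in> X" "B h k1" "B h k2" "B h k3"
    using K by (auto simp: blue_nb_def)
  have z: "z2 \<in> Q" "z3 \<in> Q" "z4 \<in> Q" "B z1 z2" "B z3 z4" "z1 \<noteq> z2" "z1 \<noteq> z3" "z1 \<noteq> z4"
    using Z cliqueQ[OF z1 z1, of z3 z4] B_irrefl by (auto simp: blue_nb_def)
  have BQ: "B y x" if "x \<in> X" "y \<in> Q" for x y using cross[OF that] B_sym by blast
  have "distinct ([h, k1, k2, k3] @ [z1, z2, z3, z4, z5])"
    using k K(2) z Z(2) z5 h z1 XQ(3) B_irrefl by auto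
  \<comment> \<open>The hub has only three neighbours in its own side, so five rim vertices come
    from \<open>Q\<close>; the rim uses the two blue edges \<open>z1 z2\<close> and
    \<open>z3 z4\<close> inside \<open>Q\<close>.\<close>
  then have "distinct [h, k1, z1, z2, k2, z3, z4, k3, z5]" by auto
  then have has_wheel
    by (rule wheelI) (use k z z5 h z1 XQ cross BQ in auto)
  with no_wheel show False ..
qed

text \<open>By counting, some side has at least \<open>n\<close> vertices, hence exactly
  \<open>n\<close>, and 4 divides \<open>n\<close>. Then \<open>V\<close> has at least
  \<open>2 * n\<close> vertices and both sides have exactly \<open>n\<close>, which
  \<open>two_sparse_sides\<close> excludes.\<close>

lemma sparse_sides:
  assumes XQ: "X \<subseteq> V" "Q \<subseteq> V" "X \<inter> Q = {}" "V = X \<union> Q"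
    and N: "2 * n - 1 \<le> card V" "4 dvd n \<Longrightarrow> 2 * n \<le> card V"
    and X: "n \<le> card X \<Longrightarrow> sparse X" and Q: "n \<le> card Q \<Longrightarrow> sparse Q"
  shows False
proof -
  have cV: "card V = card X + card Q"
    using XQ finite_subset_V by (metis card_Un_disjoint)
  have eqX: "card X = n \<and> 4 dvd n" if "n \<le> card X"
    using that card_blue_sparse[OF XQ(1) that X[OF that]] four_dvd[OF XQ(1) _ X[OF that]] by simp
  have eqQ: "card Q = n \<and> 4 dvd n" if "n \<le> card Q"
    using that card_blue_sparse[OF XQ(2) that Q[OF that]] four_dvd[OF XQ(2) _ Q[OF that]] by simp
  have "n \<le> card X \<or> n \<le> card Q"
    using cV N(1) by linarith
  then have "4 dvd n" using eqX eqQ by blast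
  then have "card X = n" "card Q = n"
    using N(2) cV eqX eqQ by linarith+
  then show False
    using two_sparse_sides[OF XQ(1-3)] X Q by simp
qed

subsection \<open>Exceptional vertices\<close>

lemma sparse_if_blue_to:
  assumes "X \<subseteq> V" "Q \<subseteq> V" "X \<inter> Q = {}" "\<And>x y. x \<in> X \<Longrightarrow> y \<in> Q \<Longrightarrow> B x y" "4 \<le> card Q"
  shows "sparse X"
  unfolding sparse_def
proof (intro ballI, rule ccontr)
  fix x assume x: "x \<in> X" "\<not> card (blue_nb X x) \<le> 3"
  have "blue_nb Q x = Q" using assms(4) x by (auto simp: blue_nb_def)
  then have has_wheel
    using wheel_bipartite[OF assms(1-4), of x] assms x by auto
  with no_wheel show False ..
qed

text \<open>A vertex of \<open>J\<close> has at most three blue edges to \<open>X\<close>, hence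
  many red ones, and the bound on red degrees leaves it at most \<open>n - card X\<close> red
  neighbours in \<open>Q\<close>, a number of at most three. So a vertex with four blue neighbours
  in \<open>X \<union> J\<close> is the hub of an alternating wheel through \<open>Q\<close>. The
  cases are the ways in which the four split between \<open>X\<close> and \<open>J\<close>.\<close>

lemma sparse_insert_exceptional:
  assumes XQJ: "X \<subseteq> V" "Q \<subseteq> V" "J \<subseteq> V" "X \<inter> Q = {}" "X \<inter> J = {}" "J \<inter> Q = {}"
    and B: "\<And>x y. x \<in> X \<Longrightarrow> y \<in> Q \<Longrightarrow> B x y"
    and cJ: "card J \<le> 3" and cQ: "4 \<le> card Q" and cXQ: "n + 5 \<le> card X + card Q"
    and deg: "\<And>x. x \<in> V \<Longrightarrow> card (red_nb V x) \<le> n - 3"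
    and big: "n \<le> card X + card J"
    and J3: "\<And>w. w \<in> J \<Longrightarrow> card (blue_nb X w) \<le> 3"
  shows "sparse (X \<union> J)"
proof -
  let ?r = "\<lambda>x. card (red_nb Q x)"
  have rX: "?r x = 0" if "x \<in> X" for x
  proof -
    have "red_nb Q x = {}" using B[OF that] by (auto simp: red_nb_def B_def)
    then show ?thesis by simp
  qed
  have red_sum: "card (red_nb X x) + card (red_nb J x) + ?r x \<le> n - 3" if "x \<in> V" for x
  proof -
    have "card (red_nb (X \<union> J \<union> Q) x) = card (red_nb X x) + card (red_nb J x) + ?r x"
      using card_red_nb_Un[of "X \<union> J" Q x] card_red_nb_Un[of X J x] XQJ by (simp add: Int_Un_distrib2)
    moreover have "card (red_nb (X \<union> J \<union> Q) x) \<le> card (red_nb V x)"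
      by (rule card_red_nb_mono) (use XQJ in auto)
    ultimately show ?thesis using deg[OF that] by linarith
  qed
  have JX: "w \<notin> X" "w \<in> V" if "w \<in> J" for w using that XQJ by auto
  have rJ: "?r w + card X \<le> n" if w: "w \<in> J" for w
    using card_neighbours_notin[OF XQJ(1) JX(1)[OF w]] J3[OF w] red_sum[OF JX(2)[OF w]] n8 by linarith
  have sX: "card (blue_nb X x) \<le> 3" if "x \<in> X" for x
    using sparse_if_blue_to[OF XQJ(1,2,4) B cQ] that by (rule sparseD)
  have bJ: "card (blue_nb J x) \<le> 3" for x
    using card_mono[OF finite_subset_V[OF XQJ(3)] blue_nb_subset[of J x]] cJ by linarith
  have split: "card (blue_nb (X \<union> J) x) = card (blue_nb X x) + card (blue_nb J x)" for x
    by (rule card_blue_nb_Un[OF XQJ(1,3,5)])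
  have wheel: False
    if h: "h \<in> X \<union> J" and k: "{k1, k2, k3, k4} \<subseteq> X \<union> J" "distinct [k1, k2, k3, k4]"
      "B h k1" "B h k2" "B h k3" "B h k4"
      and r: "2 + ?r h + ?r k1 + ?r k2 \<le> card Q" "2 + ?r h + ?r k2 + ?r k3 \<le> card Q"
      "4 + ?r h + ?r k3 + ?r k4 \<le> card Q" "4 + ?r h + ?r k4 + ?r k1 \<le> card Q"
    for h k1 k2 k3 k4
  proof -
    have d: "distinct [h, k1, k2, k3, k4]" using k B_irrefl by auto
    have "X \<union> J \<subseteq> V - Q" using XQJ by blast
    then have "{h, k1, k2, k3, k4} \<subseteq> V - Q" using h k(1) by blast
    then have has_wheel
      by (rule wheel_alternating[OF XQJ(2) d _ k(3-6) r])
    with no_wheel show False ..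
  qed
  have mem: "x \<in> blue_nb S h \<Longrightarrow> x \<in> S \<and> B h x" for x S h by (simp add: blue_nb_def)
  have XJ: "x \<in> X \<Longrightarrow> y \<in> J \<Longrightarrow> x \<noteq> y" for x y using XQJ by auto
  have hubX: "card (blue_nb (X \<union> J) x) \<le> 3" if x: "x \<in> X" for x
  proof (rule ccontr)
    assume "\<not> ?thesis"
    then have four: "4 \<le> card (blue_nb X x) + card (blue_nb J x)" using split by simp
    note rx = rX[OF x]
    consider "2 \<le> card (blue_nb X x)" "2 \<le> card (blue_nb J x)" | "3 \<le> card (blue_nb X x)" "1 \<le> card (blue_nb J x)"
      | "1 \<le> card (blue_nb X x)" "3 \<le> card (blue_nb J x)"
      using four sX[OF x] bJ[of x] by linarith
    then show False
    proof cases
      case 1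
      obtain k1 k3 k2 k4 where k: "k1 \<in> blue_nb X x" "k3 \<in> blue_nb X x" "k1 \<noteq> k3"
        "k2 \<in> blue_nb J x" "k4 \<in> blue_nb J x" "k2 \<noteq> k4"
        using ex_two[OF 1(1)] ex_two[OF 1(2)] by blast
      note m = k(1,2,4,5)[THEN mem]
      show False
        by (rule wheel[of x k1 k2 k3 k4])
          (use m k x XJ rx rX[of k1] rX[of k3] rJ[of k2] rJ[of k4] cXQ in auto)
    next
      case 2
      obtain k1 k3 k4 where k: "{k1, k3, k4} \<subseteq> blue_nb X x" "distinct [k1, k3, k4]"
        using ex_three[OF 2(1)] by blast
      then have "k1 \<in> blue_nb X x" "k3 \<in> blue_nb X x" "k4 \<in> blue_nb X x" by auto
      note m = this[THEN mem]
      obtain k2 where "k2 \<in> blue_nb J x" using ex_not_in_list[of "[]" "blue_nb J x"] 2 by auto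
      note m2 = mem[OF this]
      show False
        by (rule wheel[of x k1 k2 k3 k4])
          (use m m2 k x XJ rx rX[of k1] rX[of k3] rX[of k4] rJ[of k2] cXQ cQ in auto)
    next
      case 3
      obtain k1 k2 k3 where k: "{k1, k2, k3} \<subseteq> blue_nb J x" "distinct [k1, k2, k3]"
        using ex_three[OF 3(2)] by blast
      then have "k1 \<in> blue_nb J x" "k2 \<in> blue_nb J x" "k3 \<in> blue_nb J x" by auto
      note m = this[THEN mem]
      obtain k4 where "k4 \<in> blue_nb X x" using ex_not_in_list[of "[]" "blue_nb X x"] 3 by auto
      note m2 = mem[OF this]
      \<comment> \<open>With the vertices of \<open>J\<close> as \<open>k1\<close>,
        \<open>k2\<close>, \<open>k3\<close>, the gaps between two of them are those that need only
        two candidates.\<close>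
      show False
        by (rule wheel[of x k1 k2 k3 k4])
          (use m m2 k x XJ rx rX[of k4] rJ[of k1] rJ[of k2] rJ[of k3] cXQ big cJ in auto)
    qed
  qed
  have hubJ3: False if w: "w \<in> J" and c: "3 \<le> card (blue_nb X w)" "1 \<le> card (blue_nb J w)" for w
  proof -
    obtain k1 k3 k4 where k: "{k1, k3, k4} \<subseteq> blue_nb X w" "distinct [k1, k3, k4]"
      using ex_three[OF c(1)] by blast
    then have "k1 \<in> blue_nb X w" "k3 \<in> blue_nb X w" "k4 \<in> blue_nb X w" by auto
    note m = this[THEN mem]
    obtain k2 where "k2 \<in> blue_nb J w" using ex_not_in_list[of "[]" "blue_nb J w"] c by auto
    note m2 = mem[OF this]
    have r: "?r k1 = 0" "?r k3 = 0" "?r k4 = 0" "?r k2 + card X \<le> n"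
      using m m2 rX rJ by blast+
    have "distinct [k1, k2, k3, k4]" "{k1, k2, k3, k4} \<subseteq> X \<union> J"
      using m m2 k(2) XJ by auto
    note d = this
    show False
      by (rule wheel[of w k1 k2 k3 k4])
        (use d m m2 w r rJ[OF w] cXQ big cJ in \<open>simp_all\<close>)
  qed
  have hubJ3': "card (blue_nb X w) \<le> 2 \<or> card (blue_nb J w) = 0" if "w \<in> J" for w
  proof (rule ccontr)
    assume "\<not> ?thesis"
    then have "3 \<le> card (blue_nb X w)" "1 \<le> card (blue_nb J w)" by linarith+
    with hubJ3[OF that] show False .
  qed
  have bJ2: "card J = Suc (card (red_nb J w) + card (blue_nb J w))" if "w \<in> J" for w
    by (rule card_neighbours_mem[OF XQJ(3) that])
  have hubJ: "card (blue_nb (X \<union> J) w) \<le> 3" if w: "w \<in> J" for w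
  proof (rule ccontr)
    assume "\<not> ?thesis"
    then have four: "4 \<le> card (blue_nb X w) + card (blue_nb J w)" using split by simp
    then have two: "2 \<le> card (blue_nb X w)" "2 \<le> card (blue_nb J w)"
      using J3[OF w] bJ2[OF w] cJ hubJ3'[OF w] by linarith+
    \<comment> \<open>Here \<open>J\<close> has three elements and \<open>y\<close> has at most four
      blue neighbours in \<open>X \<union> J\<close>. Counting the red edges inside \<open>J\<close>
      as well gains one over \<open>rJ\<close>, which pays for a hub in \<open>J\<close> with two
      rim vertices in \<open>J\<close>.\<close>
    have rJ': "?r y + card X + 1 \<le> n" if y: "y \<in> J" for y
    proof -
      have "card (blue_nb X y) + card (blue_nb J y) \<le> 4"
        using J3[OF y] bJ2[OF y] cJ hubJ3'[OF y] by linarith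
      then show ?thesis
        using card_neighbours_notin[OF XQJ(1) JX(1)[OF y]] bJ2[OF y] bJ2[OF w] two red_sum[OF JX(2)[OF y]] n8
        by linarith
    qed
    obtain k1 k3 k2 k4 where k: "k1 \<in> blue_nb X w" "k3 \<in> blue_nb X w" "k1 \<noteq> k3"
      "k2 \<in> blue_nb J w" "k4 \<in> blue_nb J w" "k2 \<noteq> k4"
      using ex_two[OF two(1)] ex_two[OF two(2)] by blast
    note m = k(1,2,4,5)[THEN mem]
    have r: "?r k1 = 0" "?r k3 = 0" "?r k2 + card X + 1 \<le> n" "?r k4 + card X + 1 \<le> n"
      using m rX rJ' by blast+
    have "distinct [k1, k2, k3, k4]" "{k1, k2, k3, k4} \<subseteq> X \<union> J"
      using m k XJ by auto
    note d = this
    show False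
      by (rule wheel[of w k1 k2 k3 k4])
        (use d m w r rJ'[OF w] cXQ big cJ in \<open>simp_all\<close>)
  qed
  show ?thesis
    unfolding sparse_def using hubX hubJ by blast
qed

text \<open>A vertex of \<open>J\<close> with four blue neighbours in both sides would be a hub, so
  each joins a side in which it has at most three. The enlarged sides fall under
  \<open>sparse_sides\<close>.\<close>

lemma no_blue_partition:
  assumes VQJ: "V = X \<union> Q \<union> J" "X \<inter> Q = {}" "X \<inter> J = {}" "J \<inter> Q = {}"
    and B: "\<And>x y. x \<in> X \<Longrightarrow> y \<in> Q \<Longrightarrow> B x y"
    and c: "card J \<le> 3" "4 \<le> card X" "4 \<le> card Q"
    and N: "2 * n - 1 \<le> card V" "4 dvd n \<Longrightarrow> 2 * n \<le> card V" "16 \<le> card V"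
    and deg: "J \<noteq> {} \<Longrightarrow> \<forall>x\<in>V. card (red_nb V x) \<le> n - 3"
  shows False
proof -
  define JX where "JX = {w \<in> J. card (blue_nb X w) \<le> 3}"
  define JQ where "JQ = J - JX"
  have sub: "X \<subseteq> V" "Q \<subseteq> V" "J \<subseteq> V" "JX \<subseteq> J" "JQ \<subseteq> J" "JX \<inter> JQ = {}" "J = JX \<union> JQ"
    using VQJ by (auto simp: JX_def JQ_def)
  have fin: "finite X" "finite Q" "finite J" using sub finite_subset_V by blast+
  have BQ: "B y x" if "y \<in> Q" "x \<in> X" for x y using B[OF that(2,1)] B_sym by blast
  have JQ: "card (blue_nb Q w) \<le> 3" if w: "w \<in> JQ" for w
  proof (rule ccontr)
    assume "\<not> ?thesis"
    then have "4 \<le> card (blue_nb Q w)" by simp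
    moreover have "4 \<le> card (blue_nb X w)" "w \<in> V"
      using w sub(3) by (auto simp: JQ_def JX_def)
    ultimately have has_wheel
      using wheel_bipartite[OF sub(1,2) VQJ(2) B, of w] by blast
    with no_wheel show False ..
  qed
  have cV: "card V = card X + card Q + card J"
    using VQJ fin card_Un_disjoint[of "X \<union> Q" J] card_Un_disjoint[of X Q] by auto
  have cXQ: "n + 5 \<le> card X + card Q"
    using cV N c(1) n8 by linarith
  have cJX: "card JX \<le> 3" "card JQ \<le> 3"
    using card_mono[OF fin(3) sub(4)] card_mono[OF fin(3) sub(5)] c(1) by linarith+
  have cU: "card (X \<union> JX) = card X + card JX" "card (Q \<union> JQ) = card Q + card JQ"
    using VQJ sub fin finite_subset by (auto intro!: card_Un_disjoint)
  have sparse_X: "sparse X" and sparse_Q: "sparse Q"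
    using sparse_if_blue_to[OF sub(1,2) VQJ(2) B c(3)] sparse_if_blue_to[OF sub(2,1) _ BQ c(2)] VQJ(2)
    by blast+
  show False
  proof (rule sparse_sides[of "X \<union> JX" "Q \<union> JQ"])
    show "sparse (X \<union> JX)" if big: "n \<le> card (X \<union> JX)"
    proof (cases "J = {}")
      case True
      then show ?thesis using sub sparse_X by simp
    next
      case False
      have "X \<inter> JX = {}" "JX \<inter> Q = {}" "JX \<subseteq> V"
        using VQJ(3,4) sub(3,4) by blast+
      moreover have "n \<le> card X + card JX" using big cU by simp
      moreover have "card (blue_nb X w) \<le> 3" if "w \<in> JX" for w using that by (simp add: JX_def)
      ultimately show ?thesis
        using sparse_insert_exceptional[of X Q JX] sub(1,2) VQJ(2) B cJX(1) c(3) cXQ deg[OF False] by blast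
    qed
    show "sparse (Q \<union> JQ)" if big: "n \<le> card (Q \<union> JQ)"
    proof (cases "J = {}")
      case True
      then show ?thesis using sub sparse_Q by simp
    next
      case False
      have "Q \<inter> JQ = {}" "JQ \<inter> X = {}" "JQ \<subseteq> V" "Q \<inter> X = {}"
        using VQJ(2-4) sub(3,5) by blast+
      moreover have "n \<le> card Q + card JQ" "n + 5 \<le> card Q + card X" using big cU cXQ by simp_all
      ultimately show ?thesis
        using sparse_insert_exceptional[of Q X JQ] sub(1,2) BQ JQ cJX(2) c(2) deg[OF False] by blast
    qed
    show "(X \<union> JX) \<inter> (Q \<union> JQ) = {}" "V = X \<union> JX \<union> (Q \<union> JQ)"
      using VQJ sub(4-7) by blast+
  qed (use sub N in auto)
qed

subsection \<open>The neighbourhoods of a vertex of large red degree\<close>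

text \<open>The hypothesis yields five vertices with at most one red neighbour in \<open>S\<close>
  each. Red edges among them form a matching, and five is odd, so one of them is blue to the other
  four. It is the hub; the four alternate with vertices of the rest of \<open>S\<close>.\<close>

lemma few_red_starts:
  assumes S: "S \<subseteq> V" "A \<subseteq> S" "5 \<le> card A" "12 \<le> card S"
    and no: "\<And>a b c. a \<in> A \<Longrightarrow> b \<in> S \<Longrightarrow> c \<in> S \<Longrightarrow> a \<noteq> c \<Longrightarrow> R a b \<Longrightarrow> R b c \<Longrightarrow> False"
  shows False
proof -
  define U where "U = {x \<in> S. \<forall>y\<in>S. \<forall>z\<in>S. R x y \<longrightarrow> R x z \<longrightarrow> y = z}"
  \<comment> \<open>A red neighbour of \<open>a\<close> outside \<open>A\<close> has no red
    neighbour in \<open>S\<close> but \<open>a\<close>; if there is none, \<open>a\<close> itself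
    has at most one red neighbour in \<open>S\<close>. A common image of \<open>a\<close> and
    \<open>a'\<close> would be the middle of a forbidden path.\<close>
  define f where "f a = (if \<exists>z\<in>S - A. R a z then SOME z. z \<in> S - A \<and> R a z else a)" for a
  have f1: "f a \<in> S - A \<and> R a (f a)" if "\<exists>z\<in>S - A. R a z" for a
    using someI_ex[of "\<lambda>z. z \<in> S - A \<and> R a z"] that unfolding f_def by auto
  have f2: "f a = a" if "\<not> (\<exists>z\<in>S - A. R a z)" for a
    using that unfolding f_def by (rule if_not_P)
  have "f a \<in> U" if a: "a \<in> A" for a
  proof (cases "\<exists>z\<in>S - A. R a z")
    case True
    have "y = a" if "y \<in> S" "R (f a) y" for y
      using no[OF a _ that(1) _ _ that(2)] f1[OF True] by blast
    then show ?thesis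
      using f1[OF True] unfolding U_def by blast
  next
    case False
    have "y = z" if "y \<in> S" "z \<in> S" "R a y" "R a z" for y z
      using no[of y a z] that False a S(2) R_sym by blast
    then show ?thesis
      using f2[OF False] a S(2) unfolding U_def by auto
  qed
  then have "f ` A \<subseteq> U" by blast
  moreover have "inj_on f A"
  proof (rule inj_onI, rule ccontr)
    fix a a' assume a: "a \<in> A" "a' \<in> A" "f a = f a'" "a \<noteq> a'"
    have "R a (f a) \<and> R a' (f a) \<and> f a \<in> S"
      using f1[of a] f1[of a'] f2[of a] f2[of a'] a by (metis DiffD1 DiffD2)
    then show False
      using no[OF a(1) _ _ a(4), of "f a"] a(2) S(2) R_sym by blast
  qed
  moreover have "finite U"
    using S(1) finite_subset_V unfolding U_def by auto
  ultimately have "5 \<le> card U"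
    using card_inj_on_le[of f A U] S(3) by linarith
  then obtain T where T: "T \<subseteq> U" "card T = 5" "finite T"
    using obtain_subset_with_card_n by metis
  have TS: "T \<subseteq> S" using T unfolding U_def by blast
  have uniq: "y = z" if "x \<in> T" "y \<in> S" "z \<in> S" "R x y" "R x z" for x y z
    using that T(1) unfolding U_def by blast
  \<comment> \<open>Otherwise \<open>x1 x2\<close> and \<open>x3 x4\<close> are matched pairs and no
    partner is left for \<open>x5\<close>.\<close>
  have "\<exists>x\<in>T. \<forall>y\<in>T. \<not> R x y"
  proof (rule ccontr)
    assume "\<not> ?thesis"
    then have partner: "\<exists>y\<in>T. R x y" if "x \<in> T" for x using that by blast
    obtain x1 where x1: "x1 \<in> T" using ex_not_in_list[of "[]" T] T(2) by auto
    obtain x2 where x2: "x2 \<in> T" "R x1 x2" using partner x1 by blast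
    obtain x3 where x3: "x3 \<in> T" "x3 \<notin> set [x1, x2]" using ex_not_in_list[of "[x1, x2]" T] T(2) by auto
    obtain x4 where x4: "x4 \<in> T" "R x3 x4" using partner x3 by blast
    have x21: "R x2 x1" and x43: "R x4 x3" using x2 x4 R_sym by blast+
    have n4: "x4 \<notin> set [x1, x2, x3]"
      using uniq[of x1 x2 x3] uniq[of x2 x1 x3] x1 x2 x21 x3 x4 x43 R_irrefl TS by auto
    obtain x5 where x5: "x5 \<in> T" "x5 \<notin> set [x1, x2, x3, x4]"
      using ex_not_in_list[of "[x1, x2, x3, x4]" T] T(2) by auto
    have "x1 \<noteq> x2" using x2 R_irrefl by blast
    then have "distinct [x1, x2, x3, x4, x5]" using x3 n4 x5 by auto
    then have "card {x1, x2, x3, x4, x5} = 5" by simp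
    moreover have "{x1, x2, x3, x4, x5} \<subseteq> T" using x1 x2 x3 x4 x5 by simp
    ultimately have T_eq: "T = {x1, x2, x3, x4, x5}"
      using T(2,3) by (metis card_subset_eq)
    obtain y where y: "y \<in> T" "R x5 y" using partner x5 by blast
    then have "R y x5" using R_sym by blast
    then have "y \<noteq> x5" "y \<noteq> x1" "y \<noteq> x2" "y \<noteq> x3" "y \<noteq> x4"
      using uniq[of x1 x2 x5] uniq[of x2 x1 x5] uniq[of x3 x4 x5] uniq[of x4 x3 x5]
        x1 x2 x21 x3 x4 x43 x5 R_irrefl TS by auto
    with y T_eq show False by blast
  qed
  then obtain h where h: "h \<in> T" "\<And>y. y \<in> T \<Longrightarrow> \<not> R h y" by blast
  have "4 \<le> card (T - {h})" using T h by simp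
  then obtain k1 k2 k3 k4 where k: "{k1, k2, k3, k4} \<subseteq> T - {h}" "distinct [k1, k2, k3, k4]"
    using ex_four by meson
  let ?Q = "S - T - red_nb S h"
  have le1: "card (red_nb S x) \<le> 1" if "x \<in> T" for x
    using uniq[OF that] card_le_Suc0_iff_eq[of "red_nb S x"] finite_red_nb[OF S(1)]
    unfolding red_nb_def by fastforce
  have fin: "finite S" using S finite_subset_V by blast
  have "card S - 5 \<le> card (S - T)"
    using diff_card_le_card_Diff[OF T(3), of S] T(2) by simp
  moreover have "card (S - T) - card (red_nb S h) \<le> card ?Q"
    by (rule diff_card_le_card_Diff) (rule finite_red_nb[OF S(1)])
  ultimately have cQ: "6 \<le> card ?Q" using le1[OF h(1)] S(4) by linarith
  have r: "card (red_nb ?Q x) \<le> 1" if "x \<in> T" for x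
    using card_red_nb_mono[of ?Q S x] S(1) le1[OF that] by fastforce
  have "red_nb ?Q h = {}" unfolding red_nb_def by blast
  then have rh: "card (red_nb ?Q h) = 0" by simp
  have kT: "k1 \<in> T" "k2 \<in> T" "k3 \<in> T" "k4 \<in> T" using k by auto
  have Bk: "B h k" if "k \<in> T - {h}" for k using h that unfolding B_def by blast
  have has_wheel
    by (rule wheel_alternating[of ?Q h k1 k2 k3 k4])
      (use k kT h(1) Bk S(1) TS cQ rh r[OF kT(1)] r[OF kT(2)] r[OF kT(3)] r[OF kT(4)] in auto)
  with no_wheel show False ..
qed

text \<open>Four vertices of \<open>L\<close> would alternate with four others of \<open>Z\<close>
  on a rim around \<open>v\<close>.\<close>

lemma few_blue_to_all:
  assumes v: "v \<in> V" and Z: "Z \<subseteq> blue_nb V v" "L \<subseteq> Z" "8 \<le> card Z"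
    and B: "\<And>l z. l \<in> L \<Longrightarrow> z \<in> Z \<Longrightarrow> l \<noteq> z \<Longrightarrow> B l z"
  shows "card L \<le> 3"
proof (rule ccontr)
  assume "\<not> ?thesis"
  then have "4 \<le> card L" by simp
  then obtain k1 k2 k3 k4 where k: "{k1, k2, k3, k4} \<subseteq> L" "distinct [k1, k2, k3, k4]"
    using ex_four by meson
  let ?Q = "Z - {k1, k2, k3, k4}"
  have ZV: "Z \<subseteq> V" using Z blue_nb_subset by blast
  have cQ: "4 \<le> card ?Q"
    using card_Diff_set_ge[of Z "[k1, k2, k3, k4]"] Z(3) finite_subset_V[OF ZV] by simp
  have Bv: "B v z" if "z \<in> Z" for z using that Z(1) unfolding blue_nb_def by blast
  have "v \<notin> Z" using Bv B_irrefl by blast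
  have r: "red_nb ?Q x = {}" if "x \<in> insert v {k1, k2, k3, k4}" for x
  proof -
    have "B x z" if "z \<in> ?Q" for z
      using \<open>x \<in> _\<close> that Bv B[of x z] k(1) by auto
    then show ?thesis unfolding red_nb_def B_def by blast
  qed
  have has_wheel
    by (rule wheel_alternating[of ?Q v k1 k2 k3 k4])
      (use k v Z(2) ZV Bv cQ r \<open>v \<notin> Z\<close> in auto)
  with no_wheel show False ..
qed

text \<open>A vertex of \<open>?Z\<close> with a red neighbour in \<open>?A\<close> is blue to the
  rest of \<open>?Z\<close>, so by \<open>few_blue_to_all\<close> there are at most three such
  vertices. Moved to the side of \<open>v\<close>, they leave two sides joined completely in blue,
  with \<open>P\<close> as the exceptional set.\<close>

lemma complete_blue_partition:
  assumes v: "v \<in> V" and P: "P \<subseteq> V" "v \<notin> P" "card P \<le> 3"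
    and no: "\<And>a z c. a \<in> red_nb V v - P \<Longrightarrow> z \<in> blue_nb V v - P \<Longrightarrow> c \<in> blue_nb V v - P \<Longrightarrow> R a z \<Longrightarrow> R z c \<Longrightarrow> False"
    and c: "3 \<le> card (red_nb V v - P)" "8 \<le> card (blue_nb V v - P)"
    and deg: "P \<noteq> {} \<Longrightarrow> \<forall>x\<in>V. card (red_nb V x) \<le> n - 3"
    and N: "2 * n - 1 \<le> card V" "4 dvd n \<Longrightarrow> 2 * n \<le> card V" "16 \<le> card V"
  shows False
proof -
  let ?A = "red_nb V v - P" and ?Z = "blue_nb V v - P"
  define L where "L = {z \<in> ?Z. \<exists>a\<in>?A. R a z}"
  have ZV: "?Z \<subseteq> V" "?A \<subseteq> V" and AZ: "?A \<inter> ?Z = {}" "v \<notin> ?A" "v \<notin> ?Z"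
    using red_nb_subset blue_nb_subset R_irrefl B_irrefl by (auto simp: red_nb_def blue_nb_def B_def)
  have LZ: "L \<subseteq> ?Z" unfolding L_def by blast
  have BL: "B l z" if "l \<in> L" "z \<in> ?Z" "l \<noteq> z" for l z
    using no[of _ l z] that unfolding L_def B_def by blast
  have L3: "card L \<le> 3"
    by (rule few_blue_to_all[OF v _ LZ c(2) BL]) auto
  show False
  proof (rule no_blue_partition[of "insert v (?A \<union> L)" "?Z - L" P])
    show "V = insert v (?A \<union> L) \<union> (?Z - L) \<union> P"
      using v P(1) LZ ZV by (auto simp: red_nb_def blue_nb_def B_def)
    show "insert v (?A \<union> L) \<inter> (?Z - L) = {}" "insert v (?A \<union> L) \<inter> P = {}" "P \<inter> (?Z - L) = {}"
      using AZ P(2) LZ by auto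
    show "B x y" if "x \<in> insert v (?A \<union> L)" "y \<in> ?Z - L" for x y
    proof -
      consider "x = v" | "x \<in> ?A" | "x \<in> L" using \<open>x \<in> _\<close> by blast
      then show ?thesis
      proof cases
        case 1
        then show ?thesis using that by (simp add: blue_nb_def)
      next
        case 2
        then show ?thesis using that AZ unfolding L_def B_def by blast
      next
        case 3
        then show ?thesis using that BL by blast
      qed
    qed
    have "card (insert v ?A) \<le> card (insert v (?A \<union> L))"
      by (rule card_mono) (use finite_subset_V ZV LZ in \<open>auto intro: finite_subset\<close>)
    then show "4 \<le> card (insert v (?A \<union> L))"
      using c(1) AZ(2) finite_subset_V[OF ZV(2)] by simp
    show "4 \<le> card (?Z - L)"
      using diff_card_le_card_Diff[of L ?Z] finite_subset[OF LZ finite_subset_V[OF ZV(1)]] L3 c(2) by linarith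
  qed (use P N deg in auto)
qed

text \<open>The list \<open>xs\<close> covers the path vertices that may be red neighbours of
  \<open>v\<close> and so are lost as leaves; a short list allows a small degree of
  \<open>v\<close>.\<close>

lemma two_red_paths:
  assumes v: "v \<in> V" and d: "distinct [v, a1, b1, c1, a2, b2, c2]" "{a1, b1, c1, a2, b2, c2} \<subseteq> V"
    and R: "R v a1" "R a1 b1" "R b1 c1" "R v a2" "R a2 b2" "R b2 c2"
    and c: "red_nb V v \<inter> {a1, b1, c1, a2, b2, c2} \<subseteq> set xs" "n - 7 + length xs \<le> card (red_nb V v)"
  shows False
proof -
  have "red_nb V v - set xs \<subseteq> red_nb V v - {a1, b1, c1, a2, b2, c2}" using c(1) by blast
  then have "card (red_nb V v - set xs) \<le> card (red_nb V v - {a1, b1, c1, a2, b2, c2})"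
    by (rule card_mono[rotated]) (simp add: finite_red_nb)
  moreover have "card (red_nb V v) - length xs \<le> card (red_nb V v - set xs)"
    by (rule card_Diff_set_ge) (simp add: finite_red_nb)
  ultimately have has_tree
    using c(2) d v R by (intro treeI[of v a1 b1 c1 a2 b2 c2]) auto
  with no_tree show False ..
qed

subsection \<open>Vertices of large red degree\<close>

text \<open>Around the hub \<open>u\<close>, four vertices of \<open>C\<close> alternate with
  vertices of \<open>P\<close> and \<open>v\<close>. Two of them together are red to at most
  \<open>n - card C\<close> vertices of \<open>P\<close> and to none in \<open>{v}\<close>, and
  \<open>card P + 1\<close> exceeds this number by at least four.\<close>

lemma wheel_half:
  assumes uv: "u \<in> V" "v \<in> V" "B u v"
    and P: "P = blue_nb V u - blue_nb V v - {v}" and C: "C = blue_nb V u \<inter> blue_nb V v" "n + 3 \<le> card P + card C"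
    and four: "4 \<le> card {x \<in> C. 2 * card (red_nb P x) + card C \<le> n}"
  shows False
proof -
  obtain k1 k2 k3 k4 where k: "{k1, k2, k3, k4} \<subseteq> {x \<in> C. 2 * card (red_nb P x) + card C \<le> n}"
    and d: "distinct [k1, k2, k3, k4]"
    using ex_four[OF four] by blast
  let ?Q = "insert v P"
  have PV: "P \<subseteq> V" unfolding P blue_nb_def by blast
  have cQ: "card ?Q = Suc (card P)"
    by (rule card_insert_disjoint) (use finite_subset_V[OF PV] P in auto)
  have CB: "B u x \<and> B v x \<and> x \<in> V - ?Q \<and> x \<noteq> u" if "x \<in> C" for x
    using that B_irrefl unfolding C P blue_nb_def by blast
  have r: "2 * card (red_nb ?Q x) + card C \<le> n" if "x \<in> {k1, k2, k3, k4}" for x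
  proof -
    have "x \<in> C" "2 * card (red_nb P x) + card C \<le> n" using that k by auto
    moreover have "red_nb ?Q x = red_nb P x"
      using CB[of x] \<open>x \<in> C\<close> B_sym unfolding red_nb_def B_def by blast
    ultimately show ?thesis by simp
  qed
  have "red_nb ?Q u = {}" unfolding red_nb_def P blue_nb_def using uv(3) by (auto simp: B_def)
  then have ru: "card (red_nb ?Q u) = 0" by simp
  have kC: "k1 \<in> C" "k2 \<in> C" "k3 \<in> C" "k4 \<in> C" using k by auto
  note kB = kC[THEN CB]
  have uQ: "u \<in> V - ?Q" using uv B_irrefl unfolding P blue_nb_def by blast
  have dis: "distinct [u, k1, k2, k3, k4]" using d kB by auto
  have QV: "?Q \<subseteq> V" using PV uv(2) by blast
  have sub: "{u, k1, k2, k3, k4} \<subseteq> V - ?Q" using kB uQ by blast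
  have r': "2 * card (red_nb ?Q k1) + card C \<le> n" "2 * card (red_nb ?Q k2) + card C \<le> n"
    "2 * card (red_nb ?Q k3) + card C \<le> n" "2 * card (red_nb ?Q k4) + card C \<le> n"
    by (rule r, simp)+
  have has_wheel
  proof (rule wheel_alternating[OF QV dis sub])
    show "B u k1" "B u k2" "B u k3" "B u k4" using kB by blast+
  qed (use ru r' cQ C(2) in linarith)+
  with no_wheel show False ..
qed

text \<open>If all red degrees are at most n - 6, the ends of a blue edge \<open>uv\<close> have at
  least nine common blue neighbours, and \<open>many_low\<close> gives seven of blue degree at most
  five in \<open>C\<close>. Each of these has at least \<open>card C - 6\<close> red edges inside
  \<open>C\<close>, so at most \<open>n - card C\<close> remain for the disjoint sets
  \<open>P\<close> and \<open>P'\<close>, and one of the two gets at most half. By pigeonhole four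
  of the seven agree on the set, as \<open>wheel_half\<close> demands.\<close>

lemma red_degree_large:
  assumes N: "2 * n - 1 \<le> card V"
  shows "\<exists>v\<in>V. n - 5 \<le> card (red_nb V v)"
proof (rule ccontr)
  assume "\<not> ?thesis"
  then have red: "card (red_nb V x) + 6 \<le> n" if "x \<in> V" for x
    using that n8 by force
  have blue: "card V + 5 \<le> card (blue_nb V x) + n" if "x \<in> V" for x
    using card_neighbours_mem[OF _ that] red[OF that] by simp
  have "0 < card V" using N n8 by linarith
  then obtain u where u: "u \<in> V" using ex_not_in_list[of "[]" V] by auto
  have "0 < card (blue_nb V u)" using blue[OF u] N n8 by linarith
  then obtain v where v: "v \<in> blue_nb V u" using ex_not_in_list[of "[]" "blue_nb V u"] by auto
  then have vV: "v \<in> V" and Buv: "B u v" by (auto simp: blue_nb_def)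
  then have Bvu: "B v u" using B_sym by blast
  define C where "C = blue_nb V u \<inter> blue_nb V v"
  define P where "P = blue_nb V u - blue_nb V v - {v}"
  define P' where "P' = blue_nb V v - blue_nb V u - {u}"
  note fb = finite_blue_nb[OF subset_refl]
  have CV: "C \<subseteq> V" and PV: "P \<subseteq> V" "P' \<subseteq> V"
    unfolding C_def P_def P'_def blue_nb_def by blast+
  have "card (blue_nb V u) + card (blue_nb V v) = card (blue_nb V u \<union> blue_nb V v) + card C"
    unfolding C_def by (rule card_Un_Int) (rule fb)+
  moreover have "card (blue_nb V u \<union> blue_nb V v) \<le> card V"
    by (rule card_mono[OF finite_V]) (simp add: blue_nb_subset)
  ultimately have cC: "9 \<le> card C" using blue[OF u] blue[OF vV] N by linarith
  have "\<not> blue_path7 C"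
  proof
    assume "blue_path7 C"
    then obtain x1 x2 x3 x4 x5 x6 x7 where x: "distinct [x1, x2, x3, x4, x5, x6, x7]"
      "{x1, x2, x3, x4, x5, x6, x7} \<subseteq> C" "B x1 x2" "B x2 x3" "B x3 x4" "B x4 x5" "B x5 x6" "B x6 x7"
      unfolding blue_path7_def by (elim exE conjE) (rule that; assumption)
    have CB: "B u x \<and> B v x \<and> B x u \<and> x \<in> V \<and> x \<noteq> u \<and> x \<noteq> v" if "x \<in> C" for x
      using that B_irrefl B_sym unfolding C_def blue_nb_def by blast
    have xC: "x1 \<in> C" "x2 \<in> C" "x3 \<in> C" "x4 \<in> C" "x5 \<in> C" "x6 \<in> C" "x7 \<in> C"
      using x(2) by auto
    note xB = xC[THEN CB]
    have "u \<noteq> v" using Buv B_irrefl by blast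
    then have "distinct [v, u, x1, x2, x3, x4, x5, x6, x7]"
      using x(1) xB by auto
    then have has_wheel
      by (rule wheelI) (use x(3-) xB u vV Bvu in simp_all)
    with no_wheel show False ..
  qed
  then have low7: "7 \<le> card (low C)" by (rule many_low[OF CV _ cC])
  have split: "card (blue_nb V x) = Suc (card (blue_nb V x - blue_nb V y - {y}) + card (blue_nb V x \<inter> blue_nb V y))"
    if "y \<in> blue_nb V x" for x y
  proof -
    have "y \<in> blue_nb V x - blue_nb V y" using that by (simp add: blue_nb_def B_irrefl)
    then have "card (blue_nb V x - blue_nb V y) = Suc (card (blue_nb V x - blue_nb V y - {y}))"
      using card.remove[of "blue_nb V x - blue_nb V y" y] fb[of x] by simp
    moreover have "card (blue_nb V x) = card (blue_nb V x \<inter> blue_nb V y) + card (blue_nb V x - blue_nb V y)"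
      by (rule card_Int_Diff) (rule fb)
    ultimately show ?thesis by simp
  qed
  have u_v: "u \<in> blue_nb V v" using u Bvu by (simp add: blue_nb_def)
  have cP: "n + 3 \<le> card P + card C" "n + 3 \<le> card P' + card C"
    using split[OF v] split[OF u_v] blue[OF u] blue[OF vV] N
    unfolding C_def P_def P'_def by (simp_all add: Int_commute)
  have dis: "C \<inter> P = {}" "C \<inter> P' = {}" "P \<inter> P' = {}"
    unfolding C_def P_def P'_def by blast+
  have half: "2 * card (red_nb P x) + card C \<le> n \<or> 2 * card (red_nb P' x) + card C \<le> n" if x: "x \<in> low C" for x
  proof -
    have xC: "x \<in> C" and b: "card (blue_nb C x) \<le> 5" using x by (auto simp: low_def)
    have "card (red_nb (C \<union> P \<union> P') x) = card (red_nb C x) + card (red_nb P x) + card (red_nb P' x)"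
      using card_red_nb_Un[of "C \<union> P" P' x] card_red_nb_Un[of C P x] CV PV dis by (simp add: Int_Un_distrib2)
    moreover have "card (red_nb (C \<union> P \<union> P') x) \<le> card (red_nb V x)"
      by (rule card_red_nb_mono) (use CV PV in auto)
    ultimately show ?thesis
      using card_neighbours_mem[OF CV xC] b red[of x] xC CV by fastforce
  qed
  let ?S = "\<lambda>P. {x \<in> C. 2 * card (red_nb P x) + card C \<le> n}"
  have fC: "finite C" using CV finite_subset_V by blast
  have "low C \<subseteq> ?S P \<union> ?S P'"
    using half by (auto simp: low_def)
  then have "card (low C) \<le> card (?S P \<union> ?S P')"
    by (rule card_mono[rotated]) (simp add: fC)
  also have "\<dots> \<le> card (?S P) + card (?S P')" by (rule card_Un_le)
  finally have "4 \<le> card (?S P) \<or> 4 \<le> card (?S P')" using low7 by linarith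
  then show False
    using wheel_half[OF u vV Buv P_def C_def cP(1)]
      wheel_half[OF vV u Bvu P'_def _ cP(2)] C_def by (auto simp: Int_commute)
qed

text \<open>For n = 8 the bound of \<open>red_degree_large\<close> is only three; this improves it
  by one. If red degrees are at most three, some four vertices in the blue neighbourhood of
  \<open>v\<close> contain a vertex \<open>x\<close> with all its red neighbours there, so
  \<open>x\<close> is blue to everything outside them.\<close>

lemma red_degree_four:
  assumes N: "16 \<le> card V"
  shows "\<exists>v\<in>V. 4 \<le> card (red_nb V v)"
proof (rule ccontr)
  assume "\<not> ?thesis"
  then have red: "card (red_nb V x) \<le> 3" if "x \<in> V" for x
    using that by force
  obtain v where v: "v \<in> V" using ex_not_in_list[of "[]" V] N by auto
  let ?Z = "blue_nb V v"
  have ZV: "?Z \<subseteq> V" by (rule blue_nb_subset)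
  have cZ: "12 \<le> card ?Z"
    using card_neighbours_mem[OF subset_refl v] red[OF v] N by linarith
  obtain x where x: "x \<in> ?Z" using ex_not_in_list[of "[]" ?Z] cZ by auto
  have rZ: "card (red_nb ?Z y) \<le> 3" if "y \<in> ?Z" for y
    using card_red_nb_mono[OF ZV subset_refl, of y] red[of y] that ZV by fastforce
  have "card (insert x (red_nb ?Z x)) \<le> 4"
    using rZ[OF x] finite_red_nb[OF ZV, of x] by (simp add: card_insert_if)
  then obtain X where X: "insert x (red_nb ?Z x) \<subseteq> X" "X \<subseteq> ?Z" "card X = 4"
    using exists_subset_between[of "insert x (red_nb ?Z x)" 4 ?Z] cZ x red_nb_subset finite_subset_V[OF ZV] by force
  have "card (X - {x}) = 3" using X by simp
  then obtain k1 k2 k3 where k: "X - {x} = {k1, k2, k3}" "distinct [k1, k2, k3]"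
    by (auto simp: card_3_iff)
  let ?Q = "?Z - X"
  have "finite X" using X(2) ZV finite_subset_V by blast
  then have cQ: "8 \<le> card ?Q"
    using diff_card_le_card_Diff[of X ?Z] X cZ by simp
  have "red_nb ?Q v = {}" "red_nb ?Q x = {}"
    using X(1) by (auto simp: red_nb_def blue_nb_def B_def)
  then have r0: "card (red_nb ?Q v) = 0" "card (red_nb ?Q x) = 0" by simp_all
  have kX: "k1 \<in> X - {x}" "k2 \<in> X - {x}" "k3 \<in> X - {x}" unfolding k(1) by simp_all
  have r: "card (red_nb ?Q y) \<le> 3" if "y \<in> X" for y
    using card_red_nb_mono[of ?Q ?Z y] ZV rZ[of y] that X(2) by fastforce
  have Bv: "B v y \<and> y \<in> V - ?Q \<and> y \<noteq> v" if "y \<in> X" for y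
    using that X(2) B_irrefl unfolding blue_nb_def by blast
  have vQ: "v \<in> V - ?Q" using v by (simp add: blue_nb_def B_irrefl)
  have xX: "x \<in> X" using X(1) by blast
  note kB = kX[THEN DiffD1, THEN Bv] Bv[OF xX] and kr = kX[THEN DiffD1, THEN r]
  have QV: "?Q \<subseteq> V" using ZV by blast
  have "x \<noteq> k1" "x \<noteq> k2" "x \<noteq> k3" using kX by blast+
  then have dis: "distinct [v, k1, k2, k3, x]" using k(2) kB by auto
  have sub: "{v, k1, k2, k3, x} \<subseteq> V - ?Q" using kB vQ by blast
  \<comment> \<open>As \<open>k4\<close>, the vertex \<open>x\<close> serves the two gaps that need
    four candidates; the other gaps lose at most six of eight.\<close>
  have has_wheel
    by (rule wheel_alternating[OF QV dis sub]) (use kB r0 kr cQ in simp_all)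
  with no_wheel show False ..
qed

text \<open>The center is a vertex \<open>v\<close> of maximum red degree \<open>d\<close>. A larger
  \<open>d\<close> tolerates more path vertices among the red neighbours of \<open>v\<close>; a
  smaller one provides the blue neighbours and the degree bound for
  \<open>complete_blue_partition\<close>.\<close>

lemma no_counterexample:
  assumes N: "2 * n - 1 \<le> card V" "4 dvd n \<Longrightarrow> 2 * n \<le> card V"
  shows False
proof -
  have N16: "16 \<le> card V"
  proof (cases "n = 8")
    case True
    then show ?thesis using N(2) by simp
  next
    case False
    then show ?thesis using N(1) n8 by linarith
  qed
  have Nn: "8 + n \<le> card V"
    using N16 N(1) n8 by linarith
  have "V \<noteq> {}" using N16 by auto
  then have "Max ((\<lambda>x. card (red_nb V x)) ` V) \<in> (\<lambda>x. card (red_nb V x)) ` V"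
    using finite_V by (intro Max_in) auto
  then obtain v where v: "v \<in> V" and v_max: "card (red_nb V v) = Max ((\<lambda>x. card (red_nb V x)) ` V)"
    by force
  have max: "card (red_nb V x) \<le> card (red_nb V v)" if "x \<in> V" for x
    unfolding v_max using finite_V that by (intro Max_ge) auto
  define d where "d = card (red_nb V v)"
  have d4: "4 \<le> d" and d5: "n - 5 \<le> d"
    using red_degree_four[OF N16] red_degree_large[OF N(1)] max unfolding d_def by (meson le_trans)+
  let ?A = "red_nb V v" and ?Z = "blue_nb V v"
  have cZ: "card V = Suc (d + card ?Z)"
    unfolding d_def by (rule card_neighbours_mem[OF subset_refl v])
  have fin: "finite ?A" "finite ?Z" using finite_red_nb finite_blue_nb by blast+
  have vAZ: "v \<notin> ?A" "v \<notin> ?Z" "?A \<inter> ?Z = {}" "?A \<subseteq> V" "?Z \<subseteq> V"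
    using R_irrefl B_irrefl by (auto simp: red_nb_def blue_nb_def B_def)
  have AR: "R v a" if "a \<in> ?A" for a using that by (simp add: red_nb_def)
  have ne: "x \<noteq> y" if "R x y" for x y using that R_irrefl by blast
  \<comment> \<open>By \<open>few_red_starts\<close>, a red path that continues the star survives
    the deletion of \<open>v\<close> and of up to three further vertices.\<close>
  have starts: False
    if P: "set xs \<subseteq> V - {v}" "length xs \<le> 3" "5 \<le> card (?A - set xs)"
      and no: "\<And>a b c. a \<in> ?A - set xs \<Longrightarrow> b \<in> V - insert v (set xs) \<Longrightarrow> c \<in> V - insert v (set xs) \<Longrightarrow>
        a \<noteq> c \<Longrightarrow> R a b \<Longrightarrow> R b c \<Longrightarrow> False" for xs
  proof (rule few_red_starts[of "V - insert v (set xs)" "?A - set xs"])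
    show "12 \<le> card (V - insert v (set xs))"
      using card_Diff_set_ge[OF finite_V, of "v # xs"] P(2) N16 by simp
    show False if "a \<in> ?A - set xs" "b \<in> V - insert v (set xs)" "c \<in> V - insert v (set xs)"
      "a \<noteq> c" "R a b" "R b c" for a b c
      using no that by blast
  qed (use P vAZ in auto)
  \<comment> \<open>A path with \<open>z\<close> and \<open>c\<close> in the blue neighbourhood of
    \<open>v\<close> costs only one red neighbour of \<open>v\<close>.\<close>
  show False
  proof (cases "\<exists>a z c. a \<in> ?A \<and> z \<in> ?Z \<and> c \<in> ?Z \<and> R a z \<and> R z c")
    case True
    then obtain a z c where p: "a \<in> ?A" "z \<in> ?Z" "c \<in> ?Z" "R a z" "R z c" by blast
    have dp: "distinct [v, a, z, c]" using p vAZ ne by auto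
    have pV: "a \<in> V" "z \<in> V" "c \<in> V" using p vAZ by blast+
    \<comment> \<open>If \<open>d\<close> is at least n - 2, an arbitrary second path is affordable:
      at most four red neighbours are lost. Otherwise a second path of the same kind loses only two
      in all, for which n - 5 suffices, and its absence makes \<open>{a, z, c}\<close> the
      exceptional set.\<close>
    show False
    proof (cases "n - 2 \<le> d")
      case True
      have sub: "?A - set [a, z, c] = ?A - {a}" using p vAZ by auto
      show False
      proof (rule starts[of "[a, z, c]"])
        show "5 \<le> card (?A - set [a, z, c])"
          unfolding sub using True n8 p(1) fin d_def by simp
        fix a' b' c'
        assume q: "a' \<in> ?A - set [a, z, c]" "b' \<in> V - insert v (set [a, z, c])"
          "c' \<in> V - insert v (set [a, z, c])" "a' \<noteq> c'" "R a' b'" "R b' c'"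
        show False
        proof (rule two_red_paths[OF v, of a z c a' b' c' "[a, a', b', c']"])
          show "distinct [v, a, z, c, a', b', c']"
            using dp q ne[OF q(5)] ne[OF q(6)] vAZ(1) by auto
          show "?A \<inter> {a, z, c, a', b', c'} \<subseteq> set [a, a', b', c']"
            using p vAZ by auto
        qed (use p q pV AR True n8 vAZ d_def in auto)
      qed (use pV dp in auto)
    next
      case False
      show False
      proof (rule complete_blue_partition[OF v, of "{a, z, c}"])
        show "card {a, z, c} \<le> 3" by (simp add: card_insert_if)
        have "?A - {a, z, c} = ?A - {a}" using p vAZ by auto
        then show "3 \<le> card (?A - {a, z, c})"
          using p(1) fin d4 d_def by simp
        have "?Z - {a, z, c} = ?Z - set [z, c]" using p vAZ by auto
        then show "8 \<le> card (?Z - {a, z, c})"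
          using card_Diff_set_ge[OF fin(2), of "[z, c]"] cZ False Nn by simp
        show "\<forall>x\<in>V. card (red_nb V x) \<le> n - 3"
          using max False d_def by fastforce
        fix a' z' c'
        assume q: "a' \<in> ?A - {a, z, c}" "z' \<in> ?Z - {a, z, c}" "c' \<in> ?Z - {a, z, c}" "R a' z'" "R z' c'"
        show False
        proof (rule two_red_paths[OF v, of a z c a' z' c' "[a, a']"])
          show "distinct [v, a, z, c, a', z', c']"
            using dp q ne[OF q(4)] ne[OF q(5)] vAZ(1-3) by auto
          show "?A \<inter> {a, z, c, a', z', c'} \<subseteq> set [a, a']"
            using p q vAZ by auto
          show "n - 7 + length [a, a'] \<le> card (red_nb V v)"
            using d5 n8 d_def by simp
        qed (use p q pV AR vAZ in auto)
      qed (use pV dp N N16 in auto)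
    qed
  next
    case noZZ: False
    \<comment> \<open>If \<open>d\<close> is at least \<open>n\<close>, even six lost red neighbours
      leave n - 7 leaves. Otherwise the absence of a path through the blue neighbourhood gives a
      partition with empty exceptional set.\<close>
    show False
    proof (cases "n \<le> d")
      case True
      show False
      proof (cases "\<exists>a b c. a \<in> ?A \<and> b \<in> V - {v} \<and> c \<in> V - {v} \<and> a \<noteq> c \<and> R a b \<and> R b c")
        case ex: True
        then obtain a b c where p: "a \<in> ?A" "b \<in> V - {v}" "c \<in> V - {v}" "a \<noteq> c" "R a b" "R b c"
          by blast
        have dp: "distinct [v, a, b, c]"
          using p vAZ(1) ne[OF p(5)] ne[OF p(6)] by auto
        show False
        proof (rule starts[of "[a, b, c]"])
          show "5 \<le> card (?A - set [a, b, c])"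
            using card_Diff_set_ge[OF fin(1), of "[a, b, c]"] True n8 d_def by simp
          fix a' b' c'
          assume q: "a' \<in> ?A - set [a, b, c]" "b' \<in> V - insert v (set [a, b, c])"
            "c' \<in> V - insert v (set [a, b, c])" "a' \<noteq> c'" "R a' b'" "R b' c'"
          show False
          proof (rule two_red_paths[OF v, of a b c a' b' c' "[a, b, c, a', b', c']"])
            show "distinct [v, a, b, c, a', b', c']"
              using dp q ne[OF q(5)] ne[OF q(6)] vAZ(1) by auto
          qed (use p q AR True n8 vAZ d_def in auto)
        qed (use p dp vAZ in auto)
      next
        case no_path: False
        show False
        proof (rule starts[of "[]"])
          show "5 \<le> card (?A - set [])" using True n8 d_def by simp
          show False if "a \<in> ?A - set []" "b \<in> V - insert v (set [])" "c \<in> V - insert v (set [])"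
            "a \<noteq> c" "R a b" "R b c" for a b c
            using no_path that by (metis DiffD1 empty_set)
        qed simp_all
      qed
    next
      case False
      show False
      proof (rule complete_blue_partition[OF v, of "{}"])
        show False if "a \<in> ?A - {}" "z \<in> ?Z - {}" "c \<in> ?Z - {}" "R a z" "R z c" for a z c
          using noZZ that by blast
        show "3 \<le> card (?A - {})" using d4 d_def by simp
        show "8 \<le> card (?Z - {})" using cZ Nn False by simp
      qed (use N N16 in auto)
    qed
  qed
qed

end

subsection \<open>The Ramsey number\<close>

lemma parcs_wheel:
  "parcs (wheel m) = (let A = {(i, Suc i mod m) | i. i < m} \<union> {(m, i) | i. i < m} in A \<union> A\<inverse>)"
  by (auto simp: wheel_def parcs_mk_symmetric Let_def)

lemma pair_wf_digraph_if_pair_graph: "pair_graph G \<Longrightarrow> pair_wf_digraph G"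
  by (meson pair_graph_def pair_digraph_def pair_fin_digraph_def)

lemma contains_star22:
  assumes F: "pair_graph F" and n: "8 \<le> n"
    and tree: "red_blue.has_tree (pverts F) (\<lambda>x y. (x, y) \<in> parcs F) n"
    and rb: "red_blue (pverts F) (\<lambda>x y. (x, y) \<in> parcs F)"
  shows "contains_graph F (star22 n)"
proof -
  interpret red_blue "pverts F" "\<lambda>x y. (x, y) \<in> parcs F" n by (rule rb)
  obtain v a1 b1 c1 a2 b2 c2 L where t: "distinct [v, a1, b1, c1, a2, b2, c2]"
    "{v, a1, b1, c1, a2, b2, c2} \<subseteq> pverts F" "L \<subseteq> pverts F" "L \<inter> {v, a1, b1, c1, a2, b2, c2} = {}"
    "card L = n - 7" "\<forall>l\<in>L. (v, l) \<in> parcs F" "(v, a1) \<in> parcs F" "(a1, b1) \<in> parcs F"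
    "(b1, c1) \<in> parcs F" "(v, a2) \<in> parcs F" "(a2, b2) \<in> parcs F" "(b2, c2) \<in> parcs F"
    using tree unfolding has_tree_def by (elim exE conjE) (rule that; assumption)
  obtain ls where ls: "set ls = L" "distinct ls" "length ls = n - 7"
    using t(3,5) finite_subset_V finite_distinct_list distinct_card by metis
  \<comment> \<open>The order follows the labels of \<open>star22\<close>: center 0, path ends 1 and
    2, leaves 3 to n - 5, inner path vertices n - 4 to n - 1.\<close>
  define xs where "xs = [v, c1, c2] @ ls @ [a1, b1, a2, b2]"
  have len: "length xs = n" using ls n by (simp add: xs_def)
  have dist: "distinct xs" using t(1,4) ls by (auto simp: xs_def)
  have x: "xs ! 0 = v" "xs ! 1 = c1" "xs ! 2 = c2" by (simp_all add: xs_def)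
  have y: "xs ! (n - 4) = a1" "xs ! (n - 3) = b1" "xs ! (n - 2) = a2" "xs ! (n - 1) = b2"
    using ls n by (auto simp: xs_def nth_append nth_Cons' numeral_eq_Suc)
  have z: "xs ! i \<in> L" if "3 \<le> i" "i \<le> n - 5" for i
    using that ls n by (auto simp: xs_def nth_append nth_Cons')
  let ?A = "{(0, i) | i. 3 \<le> i \<and> i \<le> n - 5}
           \<union> {(0, n - 4), (n - 4, n - 3), (n - 3, 1), (0, n - 2), (n - 2, n - 1), (n - 1, 2)}"
  have A: "(xs ! i, xs ! j) \<in> parcs F" if "(i, j) \<in> ?A" for i j
    using that t(6-) x y z by auto
  have "parcs (star22 n) = ?A \<union> ?A\<inverse>"
    using parcs_star22[of n] n by (simp add: Let_def)
  then have "\<forall>i j. (i, j) \<in> parcs (star22 n) \<longrightarrow> (xs ! i, xs ! j) \<in> parcs F"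
    using A R_sym by (metis (no_types, lifting) Un_iff converseD)
  moreover have "inj_on ((!) xs) (pverts (star22 n))"
    using dist len n by (simp add: pverts_star22 inj_on_nth)
  moreover have "set xs \<subseteq> pverts F" using t(2,3) ls by (auto simp: xs_def)
  then have "(!) xs ` pverts (star22 n) \<subseteq> pverts F"
    using len n by (auto simp: pverts_star22)
  ultimately show ?thesis
    using contains_graph_iff[OF pair_wf_digraph_if_pair_graph[OF F] pair_wf_digraph_if_pair_graph[OF pair_graph_star22]] n by auto
qed

lemma contains_wheel8:
  assumes F: "pair_graph F"
    and wheel: "red_blue.has_wheel (pverts F) (\<lambda>x y. (x, y) \<in> parcs F)"
    and rb: "red_blue (pverts F) (\<lambda>x y. (x, y) \<in> parcs F)"
  shows "contains_graph (complement_graph F) (wheel 8)"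
proof -
  \<comment> \<open>\<open>has_wheel\<close> does not involve the tree order, so 8 is just a value
    to fill the parameter.\<close>
  interpret red_blue "pverts F" "\<lambda>x y. (x, y) \<in> parcs F" 8 by (rule rb)
  obtain h x0 x1 x2 x3 x4 x5 x6 x7 where t: "distinct [h, x0, x1, x2, x3, x4, x5, x6, x7]"
     "{h, x0, x1, x2, x3, x4, x5, x6, x7} \<subseteq> pverts F"
     "\<forall>x \<in> {x0, x1, x2, x3, x4, x5, x6, x7}. B h x"
     "B x0 x1" "B x1 x2" "B x2 x3" "B x3 x4" "B x4 x5" "B x5 x6" "B x6 x7" "B x7 x0"
    using wheel unfolding has_wheel_def by (elim exE conjE) (rule that; assumption)
  define xs where "xs = [x0, x1, x2, x3, x4, x5, x6, x7, h]"
  have dist: "distinct xs" using t(1) by (auto simp: xs_def)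
  have V: "set xs \<subseteq> pverts F" using t(2) by (auto simp: xs_def)
  have len: "length xs = 9" by (simp add: xs_def)
  have less8: "i \<in> {0, 1, 2, 3, 4, 5, 6, 7}" if "i < 8" for i :: nat using that by auto
  have rim: "B (xs ! i) (xs ! (Suc i mod 8))" if "i < 8" for i
    using less8[OF that] t(4-) by (auto simp: xs_def)
  have spoke: "B (xs ! 8) (xs ! i)" if "i < 8" for i
    using less8[OF that] t(3) by (auto simp: xs_def)
  have comp: "(xs ! i, xs ! j) \<in> parcs (complement_graph F)"
    if "B (xs ! i) (xs ! j)" "i < 9" "j < 9" for i j
    using that V nth_mem[of _ xs] len by (auto simp: complement_graph_def B_def)
  have "\<forall>i j. (i, j) \<in> parcs (wheel 8) \<longrightarrow> (xs ! i, xs ! j) \<in> parcs (complement_graph F)"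
    using comp rim spoke B_sym unfolding parcs_wheel Let_def by fastforce
  moreover have pv: "pverts (wheel 8) = {..8}" by (simp add: wheel_def)
  moreover have "inj_on ((!) xs) {..8}"
    using dist len by (intro inj_on_nth) auto
  moreover have "(!) xs ` {..8} \<subseteq> pverts (complement_graph F)"
    using V len by (auto simp: complement_graph_def subset_iff)
  ultimately show ?thesis
    using contains_graph_iff[OF pair_wf_digraph_if_pair_graph[OF pair_graph_complement_graph[OF F]] pair_wf_digraph_if_pair_graph[OF pair_graph_wheel]]
    by auto
qed

lemma ramsey_arrow_star22_wheel8:
  assumes n: "8 \<le> n" and N: "2 * n - 1 \<le> N" "4 dvd n \<Longrightarrow> 2 * n \<le> N"
  shows "ramsey_arrow N (star22 n) (wheel 8)"
  unfolding ramsey_arrow_def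
proof (intro allI impI)
  fix F :: "nat pair_pre_digraph"
  assume F: "pair_graph F \<and> card (pverts F) = N"
  then interpret F: pair_graph F by simp
  have rb: "red_blue (pverts F) (\<lambda>x y. (x, y) \<in> parcs F)"
  proof
    show "finite (pverts F)" by (rule F.pair_finite_verts)
    show "(y, x) \<in> parcs F" if "(x, y) \<in> parcs F" for x y
      using F.arcs_symmetric that by simp
    show "(x, x) \<notin> parcs F" for x using F.pair_no_loops by fastforce
  qed
  show "contains_graph F (star22 n) \<or> contains_graph (complement_graph F) (wheel 8)"
  proof (rule ccontr)
    assume "\<not> ?thesis"
    then interpret counterexample "pverts F" "\<lambda>x y. (x, y) \<in> parcs F" n
      using contains_star22[of F n] contains_wheel8[of F] F n rb
      by (auto simp: counterexample_def counterexample_axioms_def)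
    show False using no_counterexample N F by blast
  qed
qed

section \<open>Lower bounds: graphs without the tree whose complements have no wheel\<close>

definition graph_on :: "nat \<Rightarrow> (nat \<Rightarrow> nat \<Rightarrow> bool) \<Rightarrow> nat pair_pre_digraph" where
  "graph_on M E = \<lparr>pverts = {..<M}, parcs = {(i, j). i < M \<and> j < M \<and> i \<noteq> j \<and> E i j}\<rparr>"

lemma pair_graph_graph_on:
  assumes "\<And>i j. E i j \<Longrightarrow> E j i"
  shows "pair_graph (graph_on M E)"
proof -
  have "parcs (graph_on M E) \<subseteq> {..<M} \<times> {..<M}"
    by (auto simp: graph_on_def)
  then have "finite (parcs (graph_on M E))"
    by (rule finite_subset) simp
  then show ?thesis
    using assms by unfold_locales (auto simp: graph_on_def symmetric_def intro!: symI)
qed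

lemma star22_embedding:
  assumes n: "8 \<le> n" and F: "pair_graph F" and c: "contains_graph F (star22 n)"
  shows "\<exists>f. inj_on f {..<n} \<and> f ` {..<n} \<subseteq> pverts F \<and>
    (\<forall>i. 3 \<le> i \<and> i \<le> n - 5 \<longrightarrow> (f 0, f i) \<in> parcs F) \<and>
    (f 0, f (n - 4)) \<in> parcs F \<and> (f (n - 4), f (n - 3)) \<in> parcs F \<and> (f (n - 3), f 1) \<in> parcs F \<and>
    (f 0, f (n - 2)) \<in> parcs F \<and> (f (n - 2), f (n - 1)) \<in> parcs F \<and> (f (n - 1), f 2) \<in> parcs F"
proof -
  obtain f where "inj_on f (pverts (star22 n))" "f ` pverts (star22 n) \<subseteq> pverts F"
    "\<And>i j. (i, j) \<in> parcs (star22 n) \<Longrightarrow> (f i, f j) \<in> parcs F"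
    using contains_graph_iff[OF pair_wf_digraph_if_pair_graph[OF F] pair_wf_digraph_if_pair_graph[OF pair_graph_star22]] n c by auto
  then show ?thesis
    using n parcs_star22[of n] by (intro exI[of _ f]) (simp add: pverts_star22 Let_def)
qed

lemma wheel8_embedding:
  assumes F: "pair_graph F" and c: "contains_graph F (wheel 8)"
  shows "\<exists>f. inj_on f {..8} \<and> (\<forall>i<8. (f 8, f i) \<in> parcs F \<and> (f i, f (Suc i mod 8)) \<in> parcs F)"
proof -
  obtain f where f: "inj_on f (pverts (wheel 8))"
    "\<And>i j. (i, j) \<in> parcs (wheel 8) \<Longrightarrow> (f i, f j) \<in> parcs F"
    using contains_graph_iff[OF pair_wf_digraph_if_pair_graph[OF F] pair_wf_digraph_if_pair_graph[OF pair_graph_wheel]] c by auto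
  have "(8, i) \<in> parcs (wheel 8) \<and> (i, Suc i mod 8) \<in> parcs (wheel 8)" if "i < 8" for i
    unfolding parcs_wheel Let_def using that by blast
  moreover have "pverts (wheel 8) = {..8}" by (simp add: wheel_def)
  ultimately show ?thesis
    using f by (intro exI[of _ f]) simp
qed

lemma vertex_cases:
  fixes n :: nat
  assumes "8 \<le> n" "i < n"
  shows "i = 0 \<or> i = 1 \<or> i = 2 \<or> 3 \<le> i \<and> i \<le> n - 5 \<or> i = n - 4 \<or> i = n - 3 \<or> i = n - 2 \<or> i = n - 1"
proof -
  consider "i < 3" | "3 \<le> i" "i \<le> n - 5" | "n - 4 \<le> i"
    by linarith
  then show ?thesis
  proof cases
    case 3
    with assms have "i = n - 4 \<or> i = n - 3 \<or> i = n - 2 \<or> i = n - 1" by linarith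
    then show ?thesis by blast
  qed auto
qed

text \<open>The tree is connected, so its image stays in one side if no edge crosses.\<close>

lemma star22_on_one_side:
  fixes side :: "nat \<Rightarrow> bool" and n :: nat
  assumes n: "8 \<le> n" and E: "\<And>i j. E i j \<Longrightarrow> side i = side j"
    and e: "\<And>i. 3 \<le> i \<Longrightarrow> i \<le> n - 5 \<Longrightarrow> E (f 0) (f i)"
      "E (f 0) (f (n - 4))" "E (f (n - 4)) (f (n - 3))" "E (f (n - 3)) (f 1)"
      "E (f 0) (f (n - 2))" "E (f (n - 2)) (f (n - 1))" "E (f (n - 1)) (f 2)"
    and i: "i < n"
  shows "side (f i) = side (f 0)"
proof -
  note vertex_cases[OF n i]
  then show ?thesis
    using E[OF e(1)[of i]] e(2-)[THEN E] by auto
qed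

text \<open>Two disjoint cliques of order at most \<open>n - 1\<close> have no room for a connected
  graph of order \<open>n\<close>. Their complement is bipartite, while a wheel contains a
  triangle.\<close>

lemma not_arrow_two_cliques:
  assumes n: "8 \<le> n" and M: "M \<le> 2 * n - 2"
  shows "\<not> ramsey_arrow M (star22 n) (wheel 8)"
proof
  define E where "E i j \<longleftrightarrow> (i < n - 1 \<longleftrightarrow> j < n - 1)" for i j
  let ?F = "graph_on M E"
  have F: "pair_graph ?F" by (rule pair_graph_graph_on) (auto simp: E_def)
  assume "ramsey_arrow M (star22 n) (wheel 8)"
  moreover have "card (pverts ?F) = M" by (simp add: graph_on_def)
  ultimately consider "contains_graph ?F (star22 n)" | "contains_graph (complement_graph ?F) (wheel 8)"
    using F unfolding ramsey_arrow_def by blast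
  then show False
  proof cases
    case 1
    obtain f where f: "inj_on f {..<n}" "f ` {..<n} \<subseteq> {..<M}"
      and e: "\<And>i. 3 \<le> i \<Longrightarrow> i \<le> n - 5 \<Longrightarrow> E (f 0) (f i)"
        "E (f 0) (f (n - 4))" "E (f (n - 4)) (f (n - 3))" "E (f (n - 3)) (f 1)"
        "E (f 0) (f (n - 2))" "E (f (n - 2)) (f (n - 1))" "E (f (n - 1)) (f 2)"
      using star22_embedding[OF n F 1] by (auto simp: graph_on_def)
    have "(f i < n - 1) = (f 0 < n - 1)" if "i < n" for i
      by (rule star22_on_one_side[where side = "\<lambda>i. i < n - 1" and f = f and E = E, OF n _ e that])
        (simp add: E_def)
    then have "f ` {..<n} \<subseteq> {..<n - 1} \<or> f ` {..<n} \<subseteq> {n - 1..<M}"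
      using f(2) by (cases "f 0 < n - 1") (auto simp: subset_iff not_less)
    then have "card (f ` {..<n}) \<le> n - 1"
      using card_mono[of "{..<n - 1}" "f ` {..<n}"] card_mono[of "{n - 1..<M}" "f ` {..<n}"] M by auto
    then show False using f(1) n by (simp add: card_image)
  next
    case 2
    obtain f where f: "\<And>i. i < 8 \<Longrightarrow> (f 8, f i) \<in> parcs (complement_graph ?F) \<and>
        (f i, f (Suc i mod 8)) \<in> parcs (complement_graph ?F)"
      using wheel8_embedding[OF pair_graph_complement_graph[OF F] 2] by blast
    then show False
      using f[of 0] f[of 1] by (auto simp: complement_graph_def graph_on_def E_def)
  qed
qed

text \<open>The first \<open>n\<close> vertices form a complete multipartite graph with parts of
  size four, the others a clique of order at most \<open>n - 1\<close>. The tree would have to span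
  the first component, but no four of its vertices including the center are pairwise non-adjacent. A
  wheel in the complement would put five vertices into one part.\<close>

lemma not_arrow_blocks:
  assumes n: "8 \<le> n" "4 dvd n" and M: "M \<le> 2 * n - 1"
  shows "\<not> ramsey_arrow M (star22 n) (wheel 8)"
proof
  define E where "E i j \<longleftrightarrow> (i < n \<longleftrightarrow> j < n) \<and> (i < n \<longrightarrow> i div 4 \<noteq> j div 4)" for i j
  let ?F = "graph_on M E"
  have F: "pair_graph ?F" by (rule pair_graph_graph_on) (auto simp: E_def)
  have block: "{y. y div 4 = q} = {4 * q..<4 * q + 4}" for q :: nat by auto
  assume "ramsey_arrow M (star22 n) (wheel 8)"
  moreover have "card (pverts ?F) = M" by (simp add: graph_on_def)
  ultimately consider "contains_graph ?F (star22 n)" | "contains_graph (complement_graph ?F) (wheel 8)"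
    using F unfolding ramsey_arrow_def by blast
  then show False
  proof cases
    case 1
    obtain f where f: "inj_on f {..<n}" "f ` {..<n} \<subseteq> {..<M}"
      and e: "\<And>i. 3 \<le> i \<Longrightarrow> i \<le> n - 5 \<Longrightarrow> E (f 0) (f i)"
        "E (f 0) (f (n - 4))" "E (f (n - 4)) (f (n - 3))" "E (f (n - 3)) (f 1)"
        "E (f 0) (f (n - 2))" "E (f (n - 2)) (f (n - 1))" "E (f (n - 1)) (f 2)"
      using star22_embedding[OF n(1) F 1] by (auto simp: graph_on_def)
    have "(f i < n) = (f 0 < n)" if "i < n" for i
      by (rule star22_on_one_side[where side = "\<lambda>i. i < n" and f = f and E = E, OF n(1) _ e that])
        (simp add: E_def)
    then have "f ` {..<n} \<subseteq> {..<n} \<or> f ` {..<n} \<subseteq> {n..<M}"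
      using f(2) by (cases "f 0 < n") (auto simp: subset_iff not_less)
    moreover have "card (f ` {..<n}) = n" using f(1) by (simp add: card_image)
    moreover have "\<not> f ` {..<n} \<subseteq> {n..<M}"
      using card_mono[of "{n..<M}" "f ` {..<n}"] M n(1) \<open>card (f ` {..<n}) = n\<close> by auto
    ultimately have im: "f ` {..<n} = {..<n}"
      by (intro card_subset_eq) auto
    define S where "S = {i. i < n \<and> f i div 4 = f 0 div 4}"
    have "f 0 < n" using im n(1) by auto
    \<comment> \<open>Since 4 divides \<open>n\<close>, the part of the center is complete within
      the first \<open>n\<close> vertices, so exactly four tree vertices are mapped to it.\<close>
    then have "f 0 div 4 < n div 4" using n(2) by (auto elim!: dvdE simp: less_mult_imp_div_less mult.commute)
    then have "{y. y div 4 = f 0 div 4} \<subseteq> {..<n}"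
      using n(2) by (auto elim!: dvdE)
    then have "y \<in> f ` S" if "y div 4 = f 0 div 4" for y
    proof -
      have "y \<in> f ` {..<n}" using \<open>{y. _} \<subseteq> _\<close> that im by auto
      then show ?thesis using that unfolding S_def by auto
    qed
    then have "f ` S = {y. y div 4 = f 0 div 4}"
      by (auto simp: S_def)
    moreover have "inj_on f S" using f(1) by (rule inj_on_subset) (auto simp: S_def)
    ultimately have cS: "card S = 4" unfolding block by (metis card_image card_atLeastLessThan add_diff_cancel_left')
    \<comment> \<open>Only 1, 2, n - 3 and n - 1 are not adjacent to the center. They form the two
      edges \<open>{n - 3, 1}\<close> and \<open>{n - 1, 2}\<close>, so \<open>S\<close> contains at
      most one end of each, and \<open>p\<close> and \<open>q\<close> name these ends.\<close>
    define p where "p = (if 1 \<in> S then 1 else n - 3)"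
    define q where "q = (if 2 \<in> S then 2 else n - 1)"
    have "i \<in> {0, p, q}" if "i \<in> S" for i
    proof -
      have i: "i < n" "f i div 4 = f 0 div 4" using that by (auto simp: S_def)
      have no: "E (f 0) (f i) \<Longrightarrow> False" using i \<open>f 0 < n\<close> by (auto simp: E_def)
      have "i = 0 \<or> i = 1 \<or> i = 2 \<or> i = n - 3 \<or> i = n - 1"
        using vertex_cases[OF n(1) i(1)] no e(1)[of i] e(2,5) by blast
      moreover have "\<not> (1 \<in> S \<and> n - 3 \<in> S)" "\<not> (2 \<in> S \<and> n - 1 \<in> S)"
        using e(4,7) im by (auto simp: E_def S_def)
      ultimately show ?thesis using that by (auto simp: p_def q_def)
    qed
    then have "card S \<le> card {0, p, q}" by (intro card_mono) auto
    also have "\<dots> \<le> 3" by (simp add: card_insert_if)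
    finally show False using cS by simp
  next
    case 2
    obtain f where inj: "inj_on f {..8}" and f: "\<And>i. i < 8 \<Longrightarrow> (f 8, f i) \<in> parcs (complement_graph ?F) \<and>
        (f i, f (Suc i mod 8)) \<in> parcs (complement_graph ?F)"
      using wheel8_embedding[OF pair_graph_complement_graph[OF F] 2] by blast
    have spoke: "\<not> E (f 8) (f i)" and rim: "\<not> E (f i) (f (Suc i mod 8))" if "i < 8" for i
      using f[OF that] by (auto simp: complement_graph_def graph_on_def)
    have small: False if T: "T \<subseteq> {..8}" "4 < card T" "\<And>i. i \<in> T \<Longrightarrow> f i div 4 = r" for T r
    proof -
      have "f ` T \<subseteq> {4 * r..<4 * r + 4}" using T(3) block by blast
      then have "card (f ` T) \<le> 4" using card_mono[of "{4 * r..<4 * r + 4}" "f ` T"] by simp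
      moreover have "card (f ` T) = card T" using inj T(1) by (meson card_image inj_on_subset)
      ultimately show False using T(2) by simp
    qed
    show False
    proof (cases "f 8 < n")
      \<comment> \<open>A hub in the clique forces the rim into the parts, and consecutive rim
        vertices share a part: eight vertices in one part of size four.\<close>
      case False
      have lt: "f i < n" if "i < 8" for i using spoke[OF that] False by (auto simp: E_def)
      have st: "f (Suc i) div 4 = f i div 4" if "Suc i < 8" for i
        using rim[of i] lt[of i] lt[of "Suc i"] that by (auto simp: E_def)
      have eq: "i < 8 \<Longrightarrow> f i div 4 = f 0 div 4" for i
    proof (induction i)
        case (Suc i)
        then show ?case using st[of i] by linarith
      qed simp
      show False
      proof (rule small[of "{..<8}"])
        show "f i div 4 = f 0 div 4" if "i \<in> {..<8}" for i using eq that by blast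
      qed auto
    next
      case True
      have blk: "f i div 4 = f 8 div 4" if "i < 8" "f i < n" for i
        using spoke[OF that(1)] that(2) True by (auto simp: E_def)
      have alt: "f i < n \<or> f (Suc i) < n" if "Suc i < 8" for i
        using rim[of i] that by (auto simp: E_def)
      \<comment> \<open>No two consecutive rim vertices lie in the clique, so \<open>g\<close>
        selects from each of four disjoint consecutive pairs a vertex outside it. These four belong
        to the part of the hub, which makes five.\<close>
      define g where "g i = (if f i < n then i else Suc i)" for i
      have g: "f (g i) < n" if "Suc i < 8" for i using alt[OF that] by (auto simp: g_def)
      have gi: "g i = i \<or> g i = Suc i" for i by (simp add: g_def)
      have "distinct [g 0, g 2, g 4, g 6, 8]"
        using gi[of 0] gi[of 2] gi[of 4] gi[of 6] by auto
      then have "card {g 0, g 2, g 4, g 6, 8} = 5" by simp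
      moreover have "g 0 < 8" "g 2 < 8" "g 4 < 8" "g 6 < 8"
        using gi[of 0] gi[of 2] gi[of 4] gi[of 6] by auto
      ultimately show False
        by (intro small[of "{g 0, g 2, g 4, g 6, 8}" "f 8 div 4"])
          (use blk g[of 0] g[of 2] g[of 4] g[of 6] in auto)
    qed
  qed
qed

lemma ramsey_number_eqI:
  assumes "ramsey_arrow N G H" "\<And>M. M < N \<Longrightarrow> \<not> ramsey_arrow M G H"
  shows "ramsey_number G H = N"
  unfolding ramsey_number_def using assms by (intro Least_equality) (auto simp: not_less[symmetric])

theorem theorem21:
  fixes n :: nat
  assumes "n \<ge> 8"
  shows "(n mod 4 \<noteq> 0 \<longrightarrow> ramsey_number (star22 n) (wheel 8) = 2 * n - 1) \<and>
         (n mod 4 = 0 \<longrightarrow> ramsey_number (star22 n) (wheel 8) = 2 * n)"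
proof (intro conjI impI)
  show "ramsey_number (star22 n) (wheel 8) = 2 * n - 1" if "n mod 4 \<noteq> 0"
  proof (rule ramsey_number_eqI)
    show "ramsey_arrow (2 * n - 1) (star22 n) (wheel 8)"
      using that by (intro ramsey_arrow_star22_wheel8[OF assms]) auto
    show "\<not> ramsey_arrow M (star22 n) (wheel 8)" if "M < 2 * n - 1" for M
      using not_arrow_two_cliques[OF assms, of M] that by simp
  qed
  show "ramsey_number (star22 n) (wheel 8) = 2 * n" if "n mod 4 = 0"
  proof (rule ramsey_number_eqI)
    show "ramsey_arrow (2 * n) (star22 n) (wheel 8)"
      by (intro ramsey_arrow_star22_wheel8[OF assms]) auto
    show "\<not> ramsey_arrow M (star22 n) (wheel 8)" if "M < 2 * n" for M
    proof (rule not_arrow_blocks[OF assms])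
      show "4 dvd n" using \<open>n mod 4 = 0\<close> by auto
      show "M \<le> 2 * n - 1" using that by linarith
    qed
  qed
qed

end
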